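(* Let $m,k$ be positive integers with $3\leq k\leq m^2/2$, let $\Delta$ be a subgraph of $\mathbf{K}_{m,m}$ with exactly $k$ edges, and let $\mathcal{D}(\Delta)$, $\widehat{\mathcal{D}}(\Delta)$, $x_i$, $y_j$ be as defined in the context. Consider the following conditions: (A) the number of $2$-paths in $\Delta$ is $k(k-1)/(m+1)$, or equivalently $\displaystyle\sum_{i=1}^m \binom{x_i}{2}+\sum_{j=1}^m \binom{y_j}{2}=\frac{k(k-1)}{m+1}$; (B) the number of $3$-claws in $\Delta$ is $\displaystyle\sum_{i=1}^m\binom{x_i}{3}+\sum_{j=1}^m \binom{y_j}{3}=\frac{k(k-1)(k-2)(m-2)}{3(m+1)(m^2-2)}$; (C) the number of $3$-paths in $\Delta$ is $\displaystyle\frac{k(k-1)(k-2)(m-1)}{(m+1)(m^2-2)}$. Then $\widehat{\mathcal{D}}(\Delta)$ is a $t$-design but $\mathcal{D}(\Delta)$ is not a $t$-design if and only if: (a) for $t=2$: condition (A) holds, and $$\sum_{i=1}^m\binom{x_i}{2}\ne \frac{k(k-1)}{2(m+1)};$$ (b) for $t=3$: conditions (A), (B) and (C) hold, and also either $$\sum_{i=1}^m\binom{x_i}{2}\ne \frac{k(k-1)}{2(m+1)}\quad\text{or}\quad \sum_{i=1}^m\binom{x_i}{3}\ne \frac{k(k-1)(k-2)(m-2)}{6(m+1)(m^2-2)}.$$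
   Context: Let $\mathcal{R}=\{R_1,\dots,R_m\}$ and $\mathcal{C}=\{C_1,\dots,C_m\}$ be disjoint sets of size $m$, let $\mathcal{P}=\mathcal{R}\times\mathcal{C}$, and let $\mathbf{K}_{m,m}$ be the complete bipartite graph with vertex set $\mathcal{R}\cup\mathcal{C}$ and edges all pairs $\{R,C\}$ with $R\in\mathcal{R}$, $C\in\mathcal{C}$. Subgraphs $\Delta$ of $\mathbf{K}_{m,m}$ are identified with their edge sets (isolated vertices are irrelevant). For a subgraph $\Delta$ put $B(\Delta)=\{(R,C)\in\mathcal{P} : \{R,C\}\text{ is an edge of }\Delta\}$. Let $x_i$ be the number of edges of $\Delta$ incident with $R_i$, and $y_j$ the number of edges of $\Delta$ incident with $C_j$. Let $K=\mathrm{Sym}(\mathcal{R})\times\mathrm{Sym}(\mathcal{C})$ act on $\mathbf{K}_{m,m}$ and on $\mathcal{P}$ in the natural way; let $\tau$ be the automorphism of $\mathbf{K}_{m,m}$ interchanging $R_i$ and $C_i$ for each $i$, which acts on $\mathcal{P}$ by $(R_i,C_j)\mapsto(R_j,C_i)$; and let $G=\langle K,\tau\rangle\cong \mathrm{S}_m\wr\mathrm{S}_2$. Define the incidence structures $\mathcal{D}(\Delta)=(\mathcal{P},\{B(\Delta^g) : g\in K\})$ and $\widehat{\mathcal{D}}(\Delta)=(\mathcal{P},\{B(\Delta^g) : g\in G\})$, with incidence being inclusion. An incidence structure with point set $\mathcal{P}$ and blocks that are subsets of $\mathcal{P}$ is a $t$-$(v,k,\lambda)$ design ($t,v,k,\lambda$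 positive integers) if $|\mathcal{P}|=v$, every block has size $k$, and every $t$-subset of $\mathcal{P}$ lies in exactly $\lambda$ blocks; it is a $t$-design if this holds for some $v,k,\lambda$. A $u$-path in $\Delta$ is a (not necessarily induced) subgraph that is a path with $u$ edges and $u+1$ distinct vertices (a path and its reversal are the same). A $3$-claw in $\Delta$ is a subgraph isomorphic to $\mathbf{K}_{1,3}$. *)

theory Defs
  imports Complex_Main "HOL-Combinatorics.Permutations" "HOL-Algebra.Generated_Groups"
begin

text \<open>
  The vertex classes are given by enumerations \<open>R, C :: nat \<Rightarrow> 'v\<close> that are injective on
  \<open>{1..m}\<close> and have disjoint images there. A subgraph is its set of edges, and an edge is the
  two-element set of its ends. An incidence structure is a pair (points, blocks).
\<close>

definition Kmm_edges :: "'v set \<Rightarrow> 'v set \<Rightarrow> 'v set set" where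
  "Kmm_edges Rs Cs = {{r, c} | r c. r \<in> Rs \<and> c \<in> Cs}"

definition degree :: "'v set set \<Rightarrow> 'v \<Rightarrow> nat" where
  "degree \<Delta> v = card {e \<in> \<Delta>. v \<in> e}"

definition graph_image :: "('v \<Rightarrow> 'v) \<Rightarrow> 'v set set \<Rightarrow> 'v set set" where
  "graph_image g \<Delta> = (\<lambda>e. g ` e) ` \<Delta>"

text \<open>For \<open>u \<ge> 1\<close> a path with \<open>u\<close> edges is determined by its edge set, so that a path and its
  reversal are counted once.\<close>

definition paths :: "nat \<Rightarrow> 'v set set \<Rightarrow> 'v set set set" where
  "paths u \<Delta> = {E. E \<subseteq> \<Delta> \<and>
     (\<exists>vs. distinct vs \<and> length vs = u + 1 \<and> E = {{vs ! i, vs ! (i + 1)} | i. i < u})}"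

definition claws3 :: "'v set set \<Rightarrow> 'v set set set" where
  "claws3 \<Delta> = {E. E \<subseteq> \<Delta> \<and>
     (\<exists>z a b c. distinct [z, a, b, c] \<and> E = {{z, a}, {z, b}, {z, c}})}"

definition B :: "'v set \<Rightarrow> 'v set \<Rightarrow> 'v set set \<Rightarrow> ('v \<times> 'v) set" where
  "B Rs Cs \<Delta> = {(r, c). r \<in> Rs \<and> c \<in> Cs \<and> {r, c} \<in> \<Delta>}"

definition Sym :: "'v set \<Rightarrow> ('v \<Rightarrow> 'v) monoid" where
  "Sym V = \<lparr>carrier = {p. p permutes V}, mult = (\<circ>), one = id\<rparr>"

text \<open>\<open>Sym(Rs) \<times> Sym(Cs)\<close> as a group of permutations of \<open>Rs \<union> Cs\<close>: for disjoint \<open>Rs\<close> and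
  \<open>Cs\<close>, the permutation \<open>\<sigma> \<circ> \<rho>\<close> acts as \<open>\<sigma>\<close> on \<open>Rs\<close> and as \<open>\<rho>\<close> on \<open>Cs\<close>.\<close>

definition K :: "'v set \<Rightarrow> 'v set \<Rightarrow> ('v \<Rightarrow> 'v) set" where
  "K Rs Cs = {\<sigma> \<circ> \<rho> | \<sigma> \<rho>. \<sigma> permutes Rs \<and> \<rho> permutes Cs}"

definition tau :: "nat \<Rightarrow> (nat \<Rightarrow> 'v) \<Rightarrow> (nat \<Rightarrow> 'v) \<Rightarrow> 'v \<Rightarrow> 'v" where
  "tau m R C v =
     (if v \<in> R ` {1..m} then C (inv_into {1..m} R v)
      else if v \<in> C ` {1..m} then R (inv_into {1..m} C v)
      else v)"

definition G :: "nat \<Rightarrow> (nat \<Rightarrow> 'v) \<Rightarrow> (nat \<Rightarrow> 'v) \<Rightarrow> ('v \<Rightarrow> 'v) set" where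
  "G m R C = generate (Sym (R ` {1..m} \<union> C ` {1..m}))
     (K (R ` {1..m}) (C ` {1..m}) \<union> {tau m R C})"

type_synonym 'p incidence_structure = "'p set \<times> 'p set set"

definition orbit_structure ::
  "('v \<Rightarrow> 'v) set \<Rightarrow> 'v set \<Rightarrow> 'v set \<Rightarrow> 'v set set \<Rightarrow> ('v \<times> 'v) incidence_structure" where
  "orbit_structure H Rs Cs \<Delta> = (Rs \<times> Cs, {B Rs Cs (graph_image g \<Delta>) | g. g \<in> H})"

definition D ::
  "nat \<Rightarrow> (nat \<Rightarrow> 'v) \<Rightarrow> (nat \<Rightarrow> 'v) \<Rightarrow> 'v set set \<Rightarrow> ('v \<times> 'v) incidence_structure" where
  "D m R C \<Delta> =
     orbit_structure (K (R ` {1..m}) (C ` {1..m})) (R ` {1..m}) (C ` {1..m}) \<Delta>"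

definition D_hat ::
  "nat \<Rightarrow> (nat \<Rightarrow> 'v) \<Rightarrow> (nat \<Rightarrow> 'v) \<Rightarrow> 'v set set \<Rightarrow> ('v \<times> 'v) incidence_structure" where
  "D_hat m R C \<Delta> = orbit_structure (G m R C) (R ` {1..m}) (C ` {1..m}) \<Delta>"

definition is_design ::
  "nat \<Rightarrow> nat \<Rightarrow> nat \<Rightarrow> nat \<Rightarrow> 'p incidence_structure \<Rightarrow> bool" where
  "is_design t v k l S \<longleftrightarrow>
     t > 0 \<and> v > 0 \<and> k > 0 \<and> l > 0 \<and>
     card (fst S) = v \<and>
     (\<forall>b \<in> snd S. b \<subseteq> fst S \<and> card b = k) \<and>
     (\<forall>T. T \<subseteq> fst S \<and> card T = t \<longrightarrow> card {b \<in> snd S. T \<subseteq> b} = l)"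

definition t_design :: "nat \<Rightarrow> 'p incidence_structure \<Rightarrow> bool" where
  "t_design t S \<longleftrightarrow> (\<exists>v k l. is_design t v k l S)"

definition cond_A :: "nat \<Rightarrow> nat \<Rightarrow> 'v set set \<Rightarrow> bool" where
  "cond_A m k \<Delta> \<longleftrightarrow>
     real (card (paths 2 \<Delta>)) = real k * (real k - 1) / (real m + 1)"

definition cond_B :: "nat \<Rightarrow> nat \<Rightarrow> 'v set set \<Rightarrow> bool" where
  "cond_B m k \<Delta> \<longleftrightarrow>
     real (card (claws3 \<Delta>)) =
       real k * (real k - 1) * (real k - 2) * (real m - 2)
       / (3 * (real m + 1) * ((real m)\<^sup>2 - 2))"

definition cond_C :: "nat \<Rightarrow> nat \<Rightarrow> 'v set set \<Rightarrow> bool" where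
  "cond_C m k \<Delta> \<longleftrightarrow>
     real (card (paths 3 \<Delta>)) =
       real k * (real k - 1) * (real k - 2) * (real m - 1)
       / ((real m + 1) * ((real m)\<^sup>2 - 2))"

end

theory Submission
  imports Defs
begin

text \<open>
  For a group \<open>H\<close> acting on the points, double counting shows that the orbit of a block \<open>S\<close> is a
  \<open>t\<close>-design iff every \<open>H\<close>-orbit of \<open>t\<close>-subsets of points occupies the same proportion of the
  \<open>t\<close>-subsets of \<open>S\<close> as of all \<open>t\<close>-subsets. For \<open>t \<in> {2, 3}\<close>, the \<open>K\<close>-orbit of a \<open>t\<close>-subset \<open>T\<close> of
  the grid is determined by the number of rows and the number of columns that \<open>T\<close> meets, and the
  \<open>G\<close>-orbit by the unordered pair of these numbers; for \<open>t = 3\<close> the \<open>G\<close>-orbits are the \<open>3\<close>-claws, the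
  \<open>3\<close>-paths, the \<open>2\<close>-paths with a disjoint edge and the matchings. Counting the pairs consisting of a
  \<open>2\<close>-path and a further edge expresses the third of these counts through the number of \<open>2\<close>-paths,
  and the fourth is then forced by the total.
\<close>

section \<open>Designs from group orbits\<close>

text \<open>The constants are shares of classes in the full m x m grid. Of the (m^2 choose 2) pairs,
  m(m choose 2) lie in a common row, a share of 1/(m+1). Of the (m^2 choose 3) triples, m(m choose
  3) lie in a common row, a share of (m-2)/((m+1)(m^2-2)), and (m(m-1))^2 are 3-paths, a share of
  6(m-1)/((m+1)(m^2-2)). Columns have the same shares as rows, so the unordered classes of pairs and
  claws get doubled constants. The two groups have to be compared on one set of data. Counting pairs
  with a further point works for rows and columns separately, so all six type counts of triples
  under K depend, besides k, on five numbers: row pairs, column pairs, row triples, column triples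
  and 3-paths. Under G only the sums of a row number and its column number enter, together with the
  3-paths. Once such a sum has the right value, its row half is right iff its column half is; hence
  the failure of the design property under K shows in the x_i alone.\<close>

lemma permutes_extend_lists:
  assumes "finite A" "distinct xs" "distinct ys" "length xs = length ys"
    and "set xs \<subseteq> A" "set ys \<subseteq> A"
  obtains p where "p permutes A" "map p xs = ys"
proof -
  let ?n = "length xs"
  have bxs: "bij_betw (\<lambda>i. xs ! i) {..<?n} (set xs)"
    and bys: "bij_betw (\<lambda>i. ys ! i) {..<?n} (set ys)"
    using bij_betw_nth assms by metis+
  define f where "f = (\<lambda>i. ys ! i) \<circ> inv_into {..<?n} (\<lambda>i. xs ! i)"
  have bf: "bij_betw f (set xs) (set ys)"
    unfolding f_def using bij_betw_trans bij_betw_inv_into bxs bys by blast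
  \<comment> \<open>The complements of the two lists in the finite set \<open>A\<close> have equal
    size, so any bijection between them completes the prescribed partial map.\<close>
  have "card (A - set xs) = card (A - set ys)"
    using assms by (simp add: card_Diff_subset distinct_card)
  then obtain g where bg: "bij_betw g (A - set xs) (A - set ys)"
    using assms(1) finite_same_card_bij by blast
  define p where "p = (\<lambda>x. if x \<in> A then (if x \<in> set xs then f x else g x) else x)"
  have "bij_betw p (set xs \<union> (A - set xs)) (set ys \<union> (A - set ys))"
  proof (rule bij_betw_combine)
    show "bij_betw p (set xs) (set ys)"
      using bf assms(5) by (subst bij_betw_cong[of _ _ f]) (auto simp: p_def)
    show "bij_betw p (A - set xs) (A - set ys)"
      using bg by (subst bij_betw_cong[of _ _ g]) (auto simp: p_def)
  qed auto
  moreover have "set xs \<union> (A - set xs) = A" "set ys \<union> (A - set ys) = A" using assms by auto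
  ultimately have "p permutes A"
    by (intro bij_imp_permutes) (auto simp: p_def)
  moreover have "map p xs = ys"
  proof (rule nth_equalityI)
    fix i assume "i < length (map p xs)"
    hence i: "i < ?n" by simp
    have "inv_into {..<?n} (\<lambda>i. xs ! i) (xs ! i) = i"
      using i bxs by (simp add: bij_betw_inv_into_left)
    moreover have "xs ! i \<in> A" using i assms(5) by auto
    ultimately show "map p xs ! i = ys ! i" using i by (simp add: p_def f_def)
  qed (use assms in simp)
  ultimately show thesis using that by blast
qed

lemma inj_on_image_subset_iff:
  assumes "inj_on f P" "U \<subseteq> P" "W \<subseteq> P"
  shows "f ` U \<subseteq> f ` W \<longleftrightarrow> U \<subseteq> W"
proof
  assume *: "f ` U \<subseteq> f ` W"
  show "U \<subseteq> W"
  proof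
    fix a assume a: "a \<in> U"
    hence "f a \<in> f ` W" using * by blast
    thus "a \<in> W" using inj_on_image_mem_iff[OF assms(1)] a assms(2,3) by blast
  qed
qed blast

lemma card_image_supersets:
  assumes "bij_betw ((`) f) X X" "inj_on f P" "X \<subseteq> Pow P" "s \<subseteq> P"
  shows "card {x \<in> X. f ` s \<subseteq> x} = card {x \<in> X. s \<subseteq> x}"
proof -
  have "{x \<in> X. f ` s \<subseteq> x} = (`) f ` {x \<in> X. s \<subseteq> x}"
  proof (intro equalityI subsetI)
    fix x assume x: "x \<in> {x \<in> X. f ` s \<subseteq> x}"
    hence "x \<in> (`) f ` X" using bij_betw_imp_surj_on[OF assms(1)] by simp
    then obtain y where y: "y \<in> X" "x = f ` y" by (rule imageE)
    have "y \<subseteq> P" using y assms(3) by auto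
    hence "s \<subseteq> y"
      using inj_on_image_subset_iff[OF assms(2,4)] x y(2) by simp
    thus "x \<in> (`) f ` {x \<in> X. s \<subseteq> x}" using y by blast
  next
    fix x assume "x \<in> (`) f ` {x \<in> X. s \<subseteq> x}"
    thus "x \<in> {x \<in> X. f ` s \<subseteq> x}" using bij_betwE[OF assms(1)] by auto
  qed
  moreover have "inj_on ((`) f) {x \<in> X. s \<subseteq> x}"
    using assms(1) by (auto simp: bij_betw_def intro: inj_on_subset)
  ultimately show ?thesis by (simp add: card_image)
qed

lemma card_image_subsets:
  assumes "bij_betw ((`) f) X X" "inj_on f P" "X \<subseteq> Pow P" "s \<subseteq> P"
  shows "card {x \<in> X. x \<subseteq> f ` s} = card {x \<in> X. x \<subseteq> s}"
proof -
  have "{x \<in> X. x \<subseteq> f ` s} = (`) f ` {x \<in> X. x \<subseteq> s}"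
  proof (intro equalityI subsetI)
    fix x assume x: "x \<in> {x \<in> X. x \<subseteq> f ` s}"
    hence "x \<in> (`) f ` X" using bij_betw_imp_surj_on[OF assms(1)] by simp
    then obtain y where y: "y \<in> X" "x = f ` y" by (rule imageE)
    have "y \<subseteq> P" using y assms(3) by auto
    hence "y \<subseteq> s"
      using inj_on_image_subset_iff[OF assms(2) _ assms(4)] x y(2) by simp
    thus "x \<in> (`) f ` {x \<in> X. x \<subseteq> s}" using y by blast
  next
    fix x assume "x \<in> (`) f ` {x \<in> X. x \<subseteq> s}"
    thus "x \<in> {x \<in> X. x \<subseteq> f ` s}" using bij_betwE[OF assms(1)] by auto
  qed
  moreover have "inj_on ((`) f) {x \<in> X. x \<subseteq> s}"
    using assms(1) by (auto simp: bij_betw_def intro: inj_on_subset)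
  ultimately show ?thesis by (simp add: card_image)
qed

text \<open>An injective self-map of a finite family is onto; this supplies the bijectivity that an
  inverse would give.\<close>

lemma bij_betw_image_invariant:
  assumes "finite P" "X \<subseteq> Pow P" "inj_on f P" "\<And>x. x \<in> X \<Longrightarrow> f ` x \<in> X"
  shows "bij_betw ((`) f) X X"
proof -
  have "finite X" using assms(1,2) finite_subset by blast
  moreover have "inj_on ((`) f) X"
    using assms(2,3) by (auto intro!: inj_onI simp: inj_on_image_eq_iff[of f P] Pow_def subset_iff)
  ultimately show ?thesis
    using assms(4) by (simp add: bij_betw_def endo_inj_surj image_subsetI)
qed

text \<open>The value of \<open>cl\<close> names an orbit: it is constant along \<open>A\<close>,
  and \<open>A\<close> is transitive on the t-sets that share it. The type of the names is left free
  so that ordered types (for K) and unordered types (for G) are both instances. Composition is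
  compared on \<open>P\<close> only, since the induced action on pairs is multiplicative only on the
  grid.\<close>

locale class_transitive =
  fixes P :: "'p set" and A :: "('p \<Rightarrow> 'p) set" and cl :: "'p set \<Rightarrow> 'c" and t :: nat
  assumes finite_P: "finite P"
    and inj: "g \<in> A \<Longrightarrow> inj_on g P"
    and into: "g \<in> A \<Longrightarrow> g ` P \<subseteq> P"
    and comp_closed: "\<lbrakk>g \<in> A; h \<in> A\<rbrakk> \<Longrightarrow> \<exists>f \<in> A. \<forall>x \<in> P. f x = g (h x)"
    and cl_invariant: "\<lbrakk>g \<in> A; T \<subseteq> P; card T = t\<rbrakk> \<Longrightarrow> cl (g ` T) = cl T"
    and transitive: "\<lbrakk>T \<subseteq> P; T' \<subseteq> P; card T = t; card T' = t; cl T = cl T'\<rbrakk>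
      \<Longrightarrow> \<exists>g \<in> A. g ` T = T'"
begin

definition cls :: "'c \<Rightarrow> 'p set \<Rightarrow> 'p set set" where
  "cls c X = {T. T \<subseteq> X \<and> card T = t \<and> cl T = c}"

lemma bij_cls:
  assumes "g \<in> A"
  shows "bij_betw ((`) g) (cls c P) (cls c P)"
proof (rule bij_betw_image_invariant[OF finite_P _ inj[OF assms]])
  fix T assume T: "T \<in> cls c P"
  hence "T \<subseteq> P" "card T = t" "cl T = c" by (auto simp: cls_def)
  moreover from this have "card (g ` T) = t"
    using inj[OF assms] card_image inj_on_subset by metis
  ultimately show "g ` T \<in> cls c P"
    using into[OF assms] cl_invariant[OF assms] by (auto simp: cls_def)
qed (auto simp: cls_def)

context
  fixes S assumes S: "S \<subseteq> P" and S_orbit: "\<exists>g \<in> A. g ` S = S"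
begin

definition blocks :: "'p set set" where "blocks = {g ` S | g. g \<in> A}"

lemma blocks_sub: "blocks \<subseteq> Pow P"
  using S into by (auto simp: blocks_def)

lemma finite_blocks: "finite blocks"
  using blocks_sub finite_P finite_subset by blast

text \<open>\<open>S_orbit\<close> plays the part of the identity: it makes \<open>S\<close> itself
  a block.\<close>

lemma card_blocks_pos: "card blocks > 0"
  using S_orbit finite_blocks by (auto simp: blocks_def card_gt_0_iff)

lemma bij_blocks:
  assumes "g \<in> A"
  shows "bij_betw ((`) g) blocks blocks"
proof (rule bij_betw_image_invariant[OF finite_P blocks_sub inj[OF assms]])
  fix b assume "b \<in> blocks"
  then obtain h where h: "h \<in> A" "b = h ` S" by (auto simp: blocks_def)
  obtain f where "f \<in> A" "\<forall>x \<in> P. f x = g (h x)" using comp_closed[OF assms h(1)] by blast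
  moreover from this have "g ` b = f ` S" using h(2) S
    by (auto simp: image_image subset_iff)
  ultimately show "g ` b \<in> blocks" by (auto simp: blocks_def)
qed

lemma card_block:
  assumes "b \<in> blocks"
  shows "card b = card S"
  using assms inj S by (auto simp: blocks_def intro: card_image inj_on_subset)

text \<open>Both sides count the pairs of a class member and a block containing it. Transitivity
  makes the number of blocks above a member constant on the class, and each block, being an image of
  \<open>S\<close>, contains as many members as \<open>S\<close>.\<close>

lemma double_count:
  assumes "T \<in> cls c P"
  shows "card {b \<in> blocks. T \<subseteq> b} * card (cls c P) = card blocks * card (cls c S)"
proof -
  have fin: "finite (cls c P)" using finite_P by (simp add: cls_def)
  have "sum (\<lambda>T'. card {b \<in> blocks. T' \<subseteq> b}) (cls c P) = sum (\<lambda>b. card (cls c S)) blocks"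
  proof (rule sum_multicount_gen[OF fin finite_blocks], intro ballI)
    fix b assume "b \<in> blocks"
    then obtain g where g: "g \<in> A" "b = g ` S" by (auto simp: blocks_def)
    have "card {T' \<in> cls c P. T' \<subseteq> b} = card {T' \<in> cls c P. T' \<subseteq> S}"
      unfolding g(2)
      by (rule card_image_subsets[OF bij_cls[OF g(1)] inj[OF g(1)] _ S]) (auto simp: cls_def)
    also have "{T' \<in> cls c P. T' \<subseteq> S} = cls c S" using S by (auto simp: cls_def)
    finally show "card {T' \<in> cls c P. T' \<subseteq> b} = card (cls c S)" .
  qed
  moreover have "sum (\<lambda>T'. card {b \<in> blocks. T' \<subseteq> b}) (cls c P)
      = sum (\<lambda>T'. card {b \<in> blocks. T \<subseteq> b}) (cls c P)"
  proof (rule sum.cong[OF refl])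
    fix T' assume T': "T' \<in> cls c P"
    obtain g where g: "g \<in> A" "g ` T = T'"
      using transitive assms T' unfolding cls_def by blast
    show "card {b \<in> blocks. T' \<subseteq> b} = card {b \<in> blocks. T \<subseteq> b}"
      unfolding g(2)[symmetric]
      by (rule card_image_supersets[OF bij_blocks[OF g(1)] inj[OF g(1)] blocks_sub])
        (use assms in \<open>auto simp: cls_def\<close>)
  qed
  ultimately show ?thesis by (simp add: mult.commute)
qed

text \<open>Equality of shares is written cross-multiplied so that it stays within the naturals; a
  class without members in \<open>P\<close> gives 0 = 0. The bound on \<open>t\<close> makes both
  binomials positive, so they can be cancelled.\<close>

lemma t_design_iff:
  assumes "0 < t" "t \<le> card S"
  shows "t_design t (P, blocks) \<longleftrightarrow>
    (\<forall>c. card (cls c S) * (card P choose t) = (card S choose t) * card (cls c P))"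
proof
  assume "t_design t (P, blocks)"
  then obtain l where l: "\<And>T. T \<subseteq> P \<Longrightarrow> card T = t \<Longrightarrow> card {b \<in> blocks. T \<subseteq> b} = l"
    by (auto simp: t_design_def is_design_def)
  let ?\<T> = "{T. T \<subseteq> P \<and> card T = t}"
  \<comment> \<open>Counting over all t-sets relates \<open>l\<close> to the number of blocks;
    comparison with the count inside one class then eliminates \<open>l\<close>, and the positive
    number of blocks cancels.\<close>
  have "sum (\<lambda>T. card {b \<in> blocks. T \<subseteq> b}) ?\<T> = sum (\<lambda>b. card S choose t) blocks"
  proof (rule sum_multicount_gen[OF _ finite_blocks], goal_cases)
    case 2
    show ?case
    proof
    fix b assume b: "b \<in> blocks"
    hence "b \<subseteq> P" using blocks_sub by auto
    hence "{T \<in> ?\<T>. T \<subseteq> b} = {T. T \<subseteq> b \<and> card T = t}" by auto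
    thus "card {T \<in> ?\<T>. T \<subseteq> b} = card S choose t"
      using n_subsets[of b t] finite_subset[OF \<open>b \<subseteq> P\<close> finite_P] card_block[OF b] by simp
    qed
  qed (use finite_P in auto)
  moreover have "sum (\<lambda>T. card {b \<in> blocks. T \<subseteq> b}) ?\<T> = sum (\<lambda>T. l) ?\<T>"
    by (rule sum.cong) (use l in auto)
  ultimately have total: "l * (card P choose t) = card blocks * (card S choose t)"
    using n_subsets[OF finite_P, of t] by (simp add: mult.commute)
  show "\<forall>c. card (cls c S) * (card P choose t) = (card S choose t) * card (cls c P)"
  proof
    fix c
    show "card (cls c S) * (card P choose t) = (card S choose t) * card (cls c P)"
    proof (cases "cls c P = {}")
      case True
      hence "cls c S = {}" using S by (auto simp: cls_def)
      thus ?thesis using True by simp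
    next
      case False
      then obtain T where T: "T \<in> cls c P" by blast
      hence "card {b \<in> blocks. T \<subseteq> b} = l" using l by (auto simp: cls_def)
      hence "l * card (cls c P) = card blocks * card (cls c S)" using double_count[OF T] by simp
      hence "card blocks * (card (cls c S) * (card P choose t))
          = (l * (card P choose t)) * card (cls c P)"
        by (metis mult.assoc mult.commute)
      also have "\<dots> = card blocks * ((card S choose t) * card (cls c P))"
        unfolding total by simp
      finally show ?thesis using card_blocks_pos by simp
    qed
  qed
next
  assume bal: "\<forall>c. card (cls c S) * (card P choose t) = (card S choose t) * card (cls c P)"
  have card_SP: "card S \<le> card P" using S finite_P by (rule card_mono[rotated])
  have pos: "card P choose t > 0" "card S choose t > 0" using assms card_SP by auto
  have lam: "card {b \<in> blocks. T \<subseteq> b} * (card P choose t) = card blocks * (card S choose t)"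
    if "T \<subseteq> P" "card T = t" for T
  proof -
    have T: "T \<in> cls (cl T) P" using that by (simp add: cls_def)
    hence cpos: "card (cls (cl T) P) > 0"
      using finite_P by (auto simp: card_gt_0_iff cls_def)
    have "card {b \<in> blocks. T \<subseteq> b} * (card P choose t) * card (cls (cl T) P)
        = card blocks * (card (cls (cl T) S) * (card P choose t))"
      using arg_cong[OF double_count[OF T], of "\<lambda>n. n * (card P choose t)"]
      by (simp add: mult_ac)
    also have "\<dots> = card blocks * (card S choose t) * card (cls (cl T) P)"
      using bal by simp
    finally show ?thesis using cpos by simp
  qed
  \<comment> \<open>The common value is read off at one t-set, which makes it a natural number
    without any divisibility argument; \<open>lam\<close> shows that every other t-set gives the
    same value.\<close>
  obtain T0 where T0: "T0 \<subseteq> P" "card T0 = t"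
    using assms(2) card_SP by (metis obtain_subset_with_card_n order.trans)
  define l where "l = card {b \<in> blocks. T0 \<subseteq> b}"
  have l0: "l * (card P choose t) = card blocks * (card S choose t)"
    unfolding l_def by (rule lam[OF T0])
  hence "l > 0" using card_blocks_pos pos by (metis mult_is_0 neq0_conv)
  moreover have "card {b \<in> blocks. T \<subseteq> b} = l" if "T \<subseteq> P" "card T = t" for T
  proof -
    have "card {b \<in> blocks. T \<subseteq> b} * (card P choose t) = l * (card P choose t)"
      using lam[OF that] l0 by simp
    thus ?thesis using pos(1) by simp
  qed
  ultimately have "is_design t (card P) (card S) l (P, blocks)"
    using assms card_SP blocks_sub card_block by (auto simp: is_design_def)
  thus "t_design t (P, blocks)" unfolding t_design_def by blast
qed

end

end

section \<open>Types of pairs and triples of grid points\<close>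

text \<open>Used with \<open>f\<close> equal to \<open>fst\<close> or \<open>snd\<close>; then a = 1
  selects the t-sets inside one row or one column, which are the t-edge stars centred in the
  respective vertex class.\<close>

definition subset_count :: "nat \<Rightarrow> ('a \<Rightarrow> 'b) \<Rightarrow> nat \<Rightarrow> 'a set \<Rightarrow> nat" where
  "subset_count t f a X = card {T. T \<subseteq> X \<and> card T = t \<and> card (f ` T) = a}"

definition type :: "('a \<times> 'b) set \<Rightarrow> nat \<times> nat" where
  "type T = (card (fst ` T), card (snd ` T))"

definition type_count :: "nat \<Rightarrow> nat \<times> nat \<Rightarrow> ('a \<times> 'b) set \<Rightarrow> nat" where
  "type_count t c X = card {T. T \<subseteq> X \<and> card T = t \<and> type T = c}"

text \<open>A set with a one-point image lies in exactly one fibre. The condition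
  \<open>t > 0\<close> excludes the empty set, which would lie in all of them.\<close>

lemma subset_count_one:
  fixes f :: "'a \<Rightarrow> 'b"
  assumes "finite X" "finite I" "f ` X \<subseteq> I" "t > 0"
  shows "subset_count t f 1 X = (\<Sum>r\<in>I. card {p \<in> X. f p = r} choose t)"
proof -
  let ?F = "\<lambda>r. {T. T \<subseteq> {p \<in> X. f p = r} \<and> card T = t}"
  have "{T. T \<subseteq> X \<and> card T = t \<and> card (f ` T) = 1} = (\<Union>r\<in>I. ?F r)" (is "?L = ?R")
  proof (intro equalityI subsetI)
    fix T assume T: "T \<in> ?L"
    then obtain r where r: "f ` T = {r}" by (auto simp: card_1_singleton_iff)
    hence "r \<in> I" using T assms(3) by auto
    thus "T \<in> ?R" using T r by auto
  next
    fix T assume "T \<in> ?R"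
    then obtain r where r: "T \<subseteq> {p \<in> X. f p = r}" "card T = t" by auto
    hence "T \<noteq> {}" using assms(4) by auto
    hence "f ` T = {r}" using r by auto
    thus "T \<in> ?L" using r by auto
  qed
  moreover have "card (\<Union>r\<in>I. ?F r) = (\<Sum>r\<in>I. card (?F r))"
  proof (rule card_UN_disjoint[OF assms(2)])
    show "\<forall>r\<in>I. finite (?F r)" using assms(1) by auto
    show "\<forall>r\<in>I. \<forall>s\<in>I. r \<noteq> s \<longrightarrow> ?F r \<inter> ?F s = {}"
    proof (intro ballI impI)
      fix r s :: 'b assume "r \<noteq> s"
      { fix T assume "T \<in> ?F r \<inter> ?F s"
        moreover from this have "T \<noteq> {}" using assms(4) by auto
        ultimately have False using \<open>r \<noteq> s\<close> by blast }
      thus "?F r \<inter> ?F s = {}" by blast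
    qed
  qed
  moreover have "card (?F r) = card {p \<in> X. f p = r} choose t" for r :: 'b
    using assms(1) by (intro n_subsets) simp
  ultimately show ?thesis by (simp add: subset_count_def)
qed

text \<open>A triple inside one fibre has all 3 of its pairs there; a triple meeting two fibres
  splits as 2 + 1 and has a single such pair; one meeting three fibres has none.\<close>

lemma card_collinear_pairs:
  assumes "card T = 3"
  shows "card {U. U \<subseteq> T \<and> card U = 2 \<and> card (f ` U) = 1} =
    (if card (f ` T) = 1 then 3 else if card (f ` T) = 2 then 1 else 0)"
proof -
  obtain p q r where T: "T = {p, q, r}" "p \<noteq> q" "p \<noteq> r" "q \<noteq> r"
    using assms by (auto simp: card_3_iff)
  have sub: "U \<subseteq> T \<and> card U = 2 \<longleftrightarrow> U \<in> {{p, q}, {p, r}, {q, r}}" for U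
    unfolding T(1) using T(2-4) by (auto simp: card_2_iff)
  have "{U. U \<subseteq> T \<and> card U = 2 \<and> card (f ` U) = 1}
      = {U \<in> {{p, q}, {p, r}, {q, r}}. card (f ` U) = 1}"
    unfolding conj_assoc[symmetric] sub ..
  also have "\<dots> = (if f p = f q then {{p, q}} else {}) \<union> (if f p = f r then {{p, r}} else {})
      \<union> (if f q = f r then {{q, r}} else {})"
    by (auto simp: card_insert_if)
  finally show ?thesis
    using T by (auto simp: card_insert_if doubleton_eq_iff)
qed

text \<open>Double counting of pairs U inside one fibre and triples T containing U: each U extends
  by any of the remaining \<open>card X - 2\<close> points, and each T is weighted by its number of
  such pairs. If \<open>X\<close> has fewer than two points, there is no U and truncated subtraction
  does no harm.\<close>

lemma subset_count_pairs_triples: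
  assumes "finite X"
  shows "subset_count 2 f 1 X * (card X - 2) = 3 * subset_count 3 f 1 X + subset_count 3 f 2 X"
proof -
  let ?U = "{U. U \<subseteq> X \<and> card U = 2 \<and> card (f ` U) = 1}"
  let ?T = "{T. T \<subseteq> X \<and> card T = 3}"
  let ?n = "\<lambda>T. if card (f ` T) = 1 then 3 else if card (f ` T) = 2 then 1 else (0::nat)"
  have fin: "finite ?U" "finite ?T" using assms by auto
  have "sum (\<lambda>U. card {T \<in> ?T. U \<subseteq> T}) ?U = sum ?n ?T"
  proof (rule sum_multicount_gen[OF fin], rule ballI)
    fix T assume T: "T \<in> ?T"
    hence "{U \<in> ?U. U \<subseteq> T} = {U. U \<subseteq> T \<and> card U = 2 \<and> card (f ` U) = 1}" by auto
    thus "card {U \<in> ?U. U \<subseteq> T} = ?n T" using card_collinear_pairs[of T f] T by simp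
  qed
  also have "sum ?n ?T = (\<Sum>T\<in>?T. 3 * (if card (f ` T) = 1 then 1 else 0)
      + (if card (f ` T) = 2 then 1 else 0))"
    by (rule sum.cong) auto
  also have "\<dots> = 3 * subset_count 3 f 1 X + subset_count 3 f 2 X"
    using fin(2) by (simp add: sum.distrib sum_distrib_left[symmetric] subset_count_def
        sum.If_cases Collect_conj_eq Int_assoc)
  also have "sum (\<lambda>U. card {T \<in> ?T. U \<subseteq> T}) ?U = sum (\<lambda>U. card X - 2) ?U"
  proof (rule sum.cong[OF refl])
    fix U assume U: "U \<in> ?U"
    hence finU: "finite U" using card_ge_0_finite by force
    have "{T \<in> ?T. U \<subseteq> T} = (\<lambda>x. insert x U) ` (X - U)"
    proof (intro equalityI subsetI)
      fix T assume T: "T \<in> {T \<in> ?T. U \<subseteq> T}"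
      hence "card (T - U) = 1" using U finU by (simp add: card_Diff_subset)
      then obtain x where "T - U = {x}" by (auto simp: card_1_singleton_iff)
      hence "T = insert x U" "x \<in> X - U" using T by auto
      thus "T \<in> (\<lambda>x. insert x U) ` (X - U)" by blast
    qed (use U finU in auto)
    moreover have "inj_on (\<lambda>x. insert x U) (X - U)" by (auto simp: inj_on_def)
    ultimately have "card {T \<in> ?T. U \<subseteq> T} = card (X - U)" by (simp add: card_image)
    thus "card {T \<in> ?T. U \<subseteq> T} = card X - 2" using U finU by (simp add: card_Diff_subset)
  qed
  finally show ?thesis by (simp add: subset_count_def)
qed

text \<open>These are the three-edge bipartite graphs, with the sides told apart. In the case
  \<open>path\<close> the point (\<open>r\<^sub>0\<close>, \<open>c\<^sub>0\<close>) is the corner,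
  that is, the middle edge of the path.\<close>

lemma card_3_pairs_cases:
  assumes "card T = 3"
  obtains (row) r c\<^sub>0 c\<^sub>1 c\<^sub>2 where "distinct [c\<^sub>0, c\<^sub>1, c\<^sub>2]" "T = {(r, c\<^sub>0), (r, c\<^sub>1), (r, c\<^sub>2)}"
    | (column) c r\<^sub>0 r\<^sub>1 r\<^sub>2 where "distinct [r\<^sub>0, r\<^sub>1, r\<^sub>2]" "T = {(r\<^sub>0, c), (r\<^sub>1, c), (r\<^sub>2, c)}"
    | (path) r\<^sub>0 r\<^sub>1 c\<^sub>0 c\<^sub>1 where "r\<^sub>0 \<noteq> r\<^sub>1" "c\<^sub>0 \<noteq> c\<^sub>1"
        "T = {(r\<^sub>0, c\<^sub>0), (r\<^sub>0, c\<^sub>1), (r\<^sub>1, c\<^sub>0)}"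
    | (row_pair) r\<^sub>0 r\<^sub>1 c\<^sub>0 c\<^sub>1 c\<^sub>2 where "r\<^sub>0 \<noteq> r\<^sub>1" "distinct [c\<^sub>0, c\<^sub>1, c\<^sub>2]"
        "T = {(r\<^sub>0, c\<^sub>0), (r\<^sub>0, c\<^sub>1), (r\<^sub>1, c\<^sub>2)}"
    | (column_pair) c\<^sub>0 c\<^sub>1 r\<^sub>0 r\<^sub>1 r\<^sub>2 where "c\<^sub>0 \<noteq> c\<^sub>1" "distinct [r\<^sub>0, r\<^sub>1, r\<^sub>2]"
        "T = {(r\<^sub>0, c\<^sub>0), (r\<^sub>1, c\<^sub>0), (r\<^sub>2, c\<^sub>1)}"
    | (matching) r\<^sub>0 r\<^sub>1 r\<^sub>2 c\<^sub>0 c\<^sub>1 c\<^sub>2 where "distinct [r\<^sub>0, r\<^sub>1, r\<^sub>2]" "distinct [c\<^sub>0, c\<^sub>1, c\<^sub>2]"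
        "T = {(r\<^sub>0, c\<^sub>0), (r\<^sub>1, c\<^sub>1), (r\<^sub>2, c\<^sub>2)}"
proof -
  obtain p q r where T: "T = {p, q, r}" "p \<noteq> q" "p \<noteq> r" "q \<noteq> r"
    using assms by (auto simp: card_3_iff)
  obtain p1 p2 q1 q2 r1 r2 where pq: "p = (p1, p2)" "q = (q1, q2)" "r = (r1, r2)"
    by (metis surj_pair)
  \<comment> \<open>The case rules list the points in a fixed order, while the point that stands
    apart may be any of the three; hence the reorderings of \<open>T\<close>.\<close>
  have perm: "T = {p, r, q}" "T = {q, p, r}" "T = {q, r, p}" "T = {r, p, q}" "T = {r, q, p}"
    using T by auto
  note TT = T(1) perm
  consider "p1 = q1" "p1 = r1" | "p1 = q1" "p1 \<noteq> r1" | "p1 \<noteq> q1" "p1 = r1"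
    | "p1 \<noteq> q1" "p1 \<noteq> r1" "q1 = r1" | "distinct [p1, q1, r1]" by auto
  thus thesis
  proof cases
    case 1 thus thesis using row[of p2 q2 r2 p1] T pq by auto
  next
    case 2
    hence "p2 \<noteq> q2" using T pq by auto
    thus thesis
      using 2 path[of p1 r1 p2 q2] path[of p1 r1 q2 p2] row_pair[of p1 r1 p2 q2 r2] TT pq
      by (cases "p2 = r2"; cases "q2 = r2") (auto simp: insert_commute)
  next
    case 3
    hence "p2 \<noteq> r2" using T pq by auto
    thus thesis
      using 3 path[of p1 q1 p2 r2] path[of p1 q1 r2 p2] row_pair[of p1 q1 p2 r2 q2] TT pq
      by (cases "p2 = q2"; cases "q2 = r2") (auto simp: insert_commute)
  next
    case 4
    hence "q2 \<noteq> r2" using T pq by auto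
    thus thesis
      using 4 path[of q1 p1 q2 r2] path[of q1 p1 r2 q2] row_pair[of q1 p1 q2 r2 p2] TT pq
      by (cases "p2 = q2"; cases "p2 = r2") (auto simp: insert_commute)
  next
    case 5
    consider "p2 = q2" "p2 = r2" | "p2 = q2" "p2 \<noteq> r2" | "p2 \<noteq> q2" "p2 = r2"
      | "p2 \<noteq> q2" "p2 \<noteq> r2" "q2 = r2" | "distinct [p2, q2, r2]" by auto
    thus thesis
    proof cases
      case 1 thus thesis using column[of p1 q1 r1 p2] 5 T pq by auto
    next
      case 2 thus thesis using column_pair[of p2 r2 p1 q1 r1] 5 T pq by auto
    next
      case 3 thus thesis using column_pair[of p2 q2 p1 r1 q1] 5 perm(1) pq by auto
    next
      case 4 thus thesis using column_pair[of q2 p2 q1 r1 p1] 5 perm(3) pq by auto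
    next
      case 5 thus thesis using matching[of p1 q1 r1 p2 q2 r2] \<open>distinct [p1, q1, r1]\<close> T pq by auto
    qed
  qed
qed

lemma card_2_pairs_cases:
  assumes "card T = 2"
  obtains (row) r c\<^sub>0 c\<^sub>1 where "c\<^sub>0 \<noteq> c\<^sub>1" "T = {(r, c\<^sub>0), (r, c\<^sub>1)}"
    | (column) c r\<^sub>0 r\<^sub>1 where "r\<^sub>0 \<noteq> r\<^sub>1" "T = {(r\<^sub>0, c), (r\<^sub>1, c)}"
    | (matching) r\<^sub>0 r\<^sub>1 c\<^sub>0 c\<^sub>1 where "r\<^sub>0 \<noteq> r\<^sub>1" "c\<^sub>0 \<noteq> c\<^sub>1" "T = {(r\<^sub>0, c\<^sub>0), (r\<^sub>1, c\<^sub>1)}"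
proof -
  obtain p1 p2 q1 q2 where "T = {(p1, p2), (q1, q2)}" "(p1, p2) \<noteq> (q1, q2)"
    using assms by (auto simp: card_2_iff)
  thus thesis using that by (cases "p1 = q1"; cases "p2 = q2") auto
qed

abbreviation types\<^sub>2 :: "(nat \<times> nat) set" where
  "types\<^sub>2 \<equiv> {(1, 2), (2, 1), (2, 2)}"

abbreviation types\<^sub>3 :: "(nat \<times> nat) set" where
  "types\<^sub>3 \<equiv> {(1, 3), (3, 1), (2, 2), (2, 3), (3, 2), (3, 3)}"

lemma type_in_types\<^sub>2: "card T = 2 \<Longrightarrow> type T \<in> types\<^sub>2"
  by (erule card_2_pairs_cases) (auto simp: type_def card_insert_if)

lemma type_in_types\<^sub>3: "card T = 3 \<Longrightarrow> type T \<in> types\<^sub>3"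
  by (erule card_3_pairs_cases) (auto simp: type_def card_insert_if)

text \<open>The function \<open>h\<close> coarsens the type: a constant gives the total number of
  t-sets, a projection gives the number of rows or columns met, and the unordered pair gives the
  classes of G.\<close>

lemma sum_type_count_fibre:
  fixes X :: "('a \<times> 'b) set"
  assumes "finite X" "finite Y" and Y: "\<And>T :: ('a \<times> 'b) set. card T = t \<Longrightarrow> type T \<in> Y"
  shows "card {T. T \<subseteq> X \<and> card T = t \<and> h (type T) = a} = (\<Sum>c\<in>{c \<in> Y. h c = a}. type_count t c X)"
proof -
  let ?T = "{T. T \<subseteq> X \<and> card T = t \<and> h (type T) = a}"
  have "type_count t c X = (\<Sum>T\<in>{T \<in> ?T. type T = c}. 1)" if "h c = a" for c
  proof -
    have "{T \<in> ?T. type T = c} = {T. T \<subseteq> X \<and> card T = t \<and> type T = c}"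
      using that by blast
    thus ?thesis by (simp add: type_count_def)
  qed
  hence "(\<Sum>c\<in>{c \<in> Y. h c = a}. type_count t c X)
      = (\<Sum>c\<in>{c \<in> Y. h c = a}. \<Sum>T\<in>{T \<in> ?T. type T = c}. 1)"
    by (intro sum.cong) simp_all
  also have "\<dots> = (\<Sum>T\<in>?T. 1)"
  proof (rule sum.group)
    show "type ` ?T \<subseteq> {c \<in> Y. h c = a}"
      using Y by blast
  qed (use assms(1,2) in simp_all)
  finally show ?thesis by simp
qed

lemma sum_type_count:
  fixes X :: "('a \<times> 'b) set"
  assumes "finite X" "finite Y" "\<And>T :: ('a \<times> 'b) set. card T = t \<Longrightarrow> type T \<in> Y"
  shows "(\<Sum>c\<in>Y. type_count t c X) = card X choose t"
  using sum_type_count_fibre[of X Y t "\<lambda>c. ()" "()"] assms n_subsets[of X t] by simp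

lemma subset_count_eq_sum_type_count:
  fixes X :: "('a \<times> 'b) set"
  assumes "finite X" "finite Y" "\<And>T :: ('a \<times> 'b) set. card T = t \<Longrightarrow> type T \<in> Y"
    and h: "\<And>T. card (f ` T) = h (type T)"
  shows "subset_count t f a X = (\<Sum>c\<in>{c \<in> Y. h c = a}. type_count t c X)"
  unfolding subset_count_def h using sum_type_count_fibre[OF assms(1-3)] .

text \<open>Expresses every type count by the row and column counts, the 3-path count and the size
  of \<open>X\<close>. In the relations with \<open>card X - 2\<close>, a triple meeting exactly two
  rows has type (2, 2) or (2, 3), and likewise for columns.\<close>

lemma type_count_relations:
  fixes X :: "('a \<times> 'b) set"
  assumes "finite X"
  shows "type_count 2 (1, 2) X = subset_count 2 fst 1 X"
    and "type_count 2 (2, 1) X = subset_count 2 snd 1 X"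
    and "subset_count 2 fst 1 X + subset_count 2 snd 1 X + type_count 2 (2, 2) X = card X choose 2"
    and "type_count 3 (1, 3) X = subset_count 3 fst 1 X"
    and "type_count 3 (3, 1) X = subset_count 3 snd 1 X"
    and "subset_count 2 fst 1 X * (card X - 2)
      = 3 * subset_count 3 fst 1 X + type_count 3 (2, 2) X + type_count 3 (2, 3) X"
    and "subset_count 2 snd 1 X * (card X - 2)
      = 3 * subset_count 3 snd 1 X + type_count 3 (2, 2) X + type_count 3 (3, 2) X"
    and "subset_count 3 fst 1 X + subset_count 3 snd 1 X + type_count 3 (2, 2) X + type_count 3 (2, 3) X
      + type_count 3 (3, 2) X + type_count 3 (3, 3) X = card X choose 3"
proof -
  have f2: "{c \<in> types\<^sub>2. fst c = 1} = {(1, 2)}" and s2: "{c \<in> types\<^sub>2. snd c = 1} = {(2, 1)}"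
    and f3: "{c \<in> types\<^sub>3. fst c = 1} = {(1, 3)}" and s3: "{c \<in> types\<^sub>3. snd c = 1} = {(3, 1)}"
    and f4: "{c \<in> types\<^sub>3. fst c = 2} = {(2, 2), (2, 3)}"
    and s4: "{c \<in> types\<^sub>3. snd c = 2} = {(2, 2), (3, 2)}" by auto
  have f2': "subset_count 2 fst 1 X = (\<Sum>c\<in>{(1, 2)}. type_count 2 c X)"
    unfolding f2[symmetric]
      by (intro subset_count_eq_sum_type_count assms type_in_types\<^sub>2) (simp_all add: type_def)
  have s2': "subset_count 2 snd 1 X = (\<Sum>c\<in>{(2, 1)}. type_count 2 c X)"
    unfolding s2[symmetric]
      by (intro subset_count_eq_sum_type_count assms type_in_types\<^sub>2) (simp_all add: type_def)
  have f3': "subset_count 3 fst 1 X = (\<Sum>c\<in>{(1, 3)}. type_count 3 c X)"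
    unfolding f3[symmetric]
      by (intro subset_count_eq_sum_type_count assms type_in_types\<^sub>3) (simp_all add: type_def)
  have s3': "subset_count 3 snd 1 X = (\<Sum>c\<in>{(3, 1)}. type_count 3 c X)"
    unfolding s3[symmetric]
      by (intro subset_count_eq_sum_type_count assms type_in_types\<^sub>3) (simp_all add: type_def)
  have f4': "subset_count 3 fst 2 X = (\<Sum>c\<in>{(2, 2), (2, 3)}. type_count 3 c X)"
    unfolding f4[symmetric]
      by (intro subset_count_eq_sum_type_count assms type_in_types\<^sub>3) (simp_all add: type_def)
  have s4': "subset_count 3 snd 2 X = (\<Sum>c\<in>{(2, 2), (3, 2)}. type_count 3 c X)"
    unfolding s4[symmetric]
      by (intro subset_count_eq_sum_type_count assms type_in_types\<^sub>3) (simp_all add: type_def)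
  have t2: "(\<Sum>c\<in>types\<^sub>2. type_count 2 c X) = card X choose 2"
    by (intro sum_type_count assms type_in_types\<^sub>2) simp_all
  have t3: "(\<Sum>c\<in>types\<^sub>3. type_count 3 c X) = card X choose 3"
    by (intro sum_type_count assms type_in_types\<^sub>3) simp_all
  show "type_count 2 (1, 2) X = subset_count 2 fst 1 X" using f2' by simp
  show "type_count 2 (2, 1) X = subset_count 2 snd 1 X" using s2' by simp
  show "type_count 3 (1, 3) X = subset_count 3 fst 1 X" using f3' by simp
  show "type_count 3 (3, 1) X = subset_count 3 snd 1 X" using s3' by simp
  show "subset_count 2 fst 1 X + subset_count 2 snd 1 X + type_count 2 (2, 2) X = card X choose 2"
    using f2' s2' t2 by simp
  show "subset_count 3 fst 1 X + subset_count 3 snd 1 X + type_count 3 (2, 2) X + type_count 3 (2, 3) X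
      + type_count 3 (3, 2) X + type_count 3 (3, 3) X = card X choose 3"
    using f3' s3' t3 by simp
  show "subset_count 2 fst 1 X * (card X - 2)
      = 3 * subset_count 3 fst 1 X + type_count 3 (2, 2) X + type_count 3 (2, 3) X"
    using subset_count_pairs_triples[OF assms, of fst] f4' by simp
  show "subset_count 2 snd 1 X * (card X - 2)
      = 3 * subset_count 3 snd 1 X + type_count 3 (2, 2) X + type_count 3 (3, 2) X"
    using subset_count_pairs_triples[OF assms, of snd] s4' by simp
qed

text \<open>The corner is the only one of the three points that shares its row with one of the
  others and its column with the other, so it can be recovered from the set, and then so can the
  remaining two points.\<close>

lemma path_triple_inject:
  assumes "r' \<noteq> r" "c' \<noteq> c" "s' \<noteq> s" "d' \<noteq> d"
    and eq: "{(r, c), (r, c'), (r', c)} = {(s, d), (s, d'), (s', d)}"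
  shows "r = s \<and> r' = s' \<and> c = d \<and> c' = d'"
proof -
  have "(r, c) \<in> {(s, d), (s, d'), (s', d)}" "(r, c') \<in> {(s, d), (s, d'), (s', d)}"
    "(r', c) \<in> {(s, d), (s, d'), (s', d)}"
    unfolding eq[symmetric] by simp_all
  thus ?thesis using assms(1-4) by auto
qed

text \<open>A 3-path is given by its corner together with a second row and a second column, that is,
  by an ordered pair of distinct rows and an ordered pair of distinct columns.\<close>

lemma type_count_path_Times:
  fixes U :: "'a set" and V :: "'b set"
  assumes "finite U" "finite V" "card U = m" "card V = m"
  shows "type_count 3 (2, 2) (U \<times> V) = (m * (m - 1))\<^sup>2"
proof -
  let ?f = "\<lambda>((r, r'), (c, c')). {(r, c), (r, c'), (r', c)}"
  have card_U: "card (SIGMA u:U. U - {u}) = m * (m - 1)"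
    and card_V: "card (SIGMA v:V. V - {v}) = m * (m - 1)"
    using assms by (simp_all add: card_Diff_singleton)
  have "{T. T \<subseteq> U \<times> V \<and> card T = 3 \<and> type T = (2, 2)}
    = ?f ` ((SIGMA u:U. U - {u}) \<times> (SIGMA v:V. V - {v}))"
  proof (intro equalityI subsetI)
    fix T assume T: "T \<in> {T. T \<subseteq> U \<times> V \<and> card T = 3 \<and> type T = (2, 2)}"
    hence c3: "card T = 3" by simp
    from c3 show "T \<in> ?f ` ((SIGMA u:U. U - {u}) \<times> (SIGMA v:V. V - {v}))"
    proof (cases rule: card_3_pairs_cases)
      case (path r\<^sub>0 r\<^sub>1 c\<^sub>0 c\<^sub>1)
      thus ?thesis using T by (intro image_eqI[of _ _ "((r\<^sub>0, r\<^sub>1), (c\<^sub>0, c\<^sub>1))"]) auto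
    qed (use T in \<open>auto simp: type_def card_insert_if\<close>)
  next
    fix T assume "T \<in> ?f ` ((SIGMA u:U. U - {u}) \<times> (SIGMA v:V. V - {v}))"
    thus "T \<in> {T. T \<subseteq> U \<times> V \<and> card T = 3 \<and> type T = (2, 2)}"
      by (auto simp: type_def card_insert_if)
  qed
  moreover have "inj_on ?f ((SIGMA u:U. U - {u}) \<times> (SIGMA v:V. V - {v}))"
  proof (rule inj_onI)
    fix p q assume pq: "p \<in> (SIGMA u:U. U - {u}) \<times> (SIGMA v:V. V - {v})" "q \<in> (SIGMA u:U. U - {u}) \<times> (SIGMA v:V. V - {v})" "?f p = ?f q"
    obtain r r' c c' s s' d d' where eq: "p = ((r, r'), (c, c'))" "q = ((s, s'), (d, d'))"
      by (metis surj_pair)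
    thus "p = q" using path_triple_inject[of r' r c' c s' s d' d] pq by simp
  qed
  ultimately show ?thesis
    using card_U card_V
    by (simp add: type_count_def card_image card_cartesian_product power2_eq_square)
qed

section \<open>The action on the grid\<close>

text \<open>A representative of each type on row and column indices. The size \<open>t\<close>
  enters because (2, 2) is the one type shared by both sizes: a matching for pairs, a 3-path for
  triples.\<close>

definition pattern :: "nat \<Rightarrow> nat \<times> nat \<Rightarrow> (nat \<times> nat) set" where
  "pattern t c =
     (if c = (1, 2) then {(0, 0), (0, 1)}
      else if c = (2, 1) then {(0, 0), (1, 0)}
      else if c = (1, 3) then {(0, 0), (0, 1), (0, 2)}
      else if c = (3, 1) then {(0, 0), (1, 0), (2, 0)}
      else if c = (2, 3) then {(0, 0), (0, 1), (1, 2)}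
      else if c = (3, 2) then {(0, 0), (1, 0), (2, 1)}
      else if c = (3, 3) then {(0, 0), (1, 1), (2, 2)}
      else if t = 2 then {(0, 0), (1, 1)}
      else {(0, 0), (0, 1), (1, 0)})"

definition placed :: "'a list \<Rightarrow> 'b list \<Rightarrow> (nat \<times> nat) set \<Rightarrow> ('a \<times> 'b) set" where
  "placed rs cs I = (\<lambda>(i, j). (rs ! i, cs ! j)) ` I"

text \<open>The lists order the rows and columns of \<open>T\<close> so that it becomes its pattern.
  Two sets of one type then differ only in these lists, and transitivity reduces to moving one list
  to another.\<close>

definition is_normal_form :: "nat \<Rightarrow> ('a \<times> 'b) set \<Rightarrow> 'a list \<Rightarrow> 'b list \<Rightarrow> bool" where
  "is_normal_form t T rs cs \<longleftrightarrow> distinct rs \<and> distinct cs \<and> set rs = fst ` T \<and> set cs = snd ` T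
     \<and> T = placed rs cs (pattern t (type T))
     \<and> pattern t (type T) \<subseteq> {..<length rs} \<times> {..<length cs}"

lemma normal_form:
  assumes "t = 2 \<or> t = 3" "card T = t"
  obtains rs cs where "is_normal_form t T rs cs"
  using assms(1)
proof
  assume t: "t = 2"
  hence "card T = 2" using assms by simp
  thus thesis
  proof (cases rule: card_2_pairs_cases)
    case (row r c\<^sub>0 c\<^sub>1)
    thus thesis
      by (intro that[of "[r]" "[c\<^sub>0, c\<^sub>1]"])
        (simp add: t is_normal_form_def placed_def pattern_def type_def card_insert_if)
  next
    case (column c r\<^sub>0 r\<^sub>1)
    thus thesis
      by (intro that[of "[r\<^sub>0, r\<^sub>1]" "[c]"])
        (simp add: t is_normal_form_def placed_def pattern_def type_def card_insert_if)
  next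
    case (matching r\<^sub>0 r\<^sub>1 c\<^sub>0 c\<^sub>1)
    thus thesis
      by (intro that[of "[r\<^sub>0, r\<^sub>1]" "[c\<^sub>0, c\<^sub>1]"])
        (simp add: t is_normal_form_def placed_def pattern_def type_def card_insert_if)
  qed
next
  assume t: "t = 3"
  hence "card T = 3" using assms by simp
  thus thesis
  proof (cases rule: card_3_pairs_cases)
    case (row r c\<^sub>0 c\<^sub>1 c\<^sub>2)
    thus thesis
      by (intro that[of "[r]" "[c\<^sub>0, c\<^sub>1, c\<^sub>2]"])
        (simp add: t is_normal_form_def placed_def pattern_def type_def card_insert_if)
  next
    case (column c r\<^sub>0 r\<^sub>1 r\<^sub>2)
    thus thesis
      by (intro that[of "[r\<^sub>0, r\<^sub>1, r\<^sub>2]" "[c]"])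
        (simp add: t is_normal_form_def placed_def pattern_def type_def card_insert_if)
  next
    case (path r\<^sub>0 r\<^sub>1 c\<^sub>0 c\<^sub>1)
    thus thesis
      by (intro that[of "[r\<^sub>0, r\<^sub>1]" "[c\<^sub>0, c\<^sub>1]"])
        (simp add: t is_normal_form_def placed_def pattern_def type_def card_insert_if insert_commute)
  next
    case (row_pair r\<^sub>0 r\<^sub>1 c\<^sub>0 c\<^sub>1 c\<^sub>2)
    thus thesis
      by (intro that[of "[r\<^sub>0, r\<^sub>1]" "[c\<^sub>0, c\<^sub>1, c\<^sub>2]"])
        (simp add: t is_normal_form_def placed_def pattern_def type_def card_insert_if)
  next
    case (column_pair c\<^sub>0 c\<^sub>1 r\<^sub>0 r\<^sub>1 r\<^sub>2)
    thus thesis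
      by (intro that[of "[r\<^sub>0, r\<^sub>1, r\<^sub>2]" "[c\<^sub>0, c\<^sub>1]"])
        (simp add: t is_normal_form_def placed_def pattern_def type_def card_insert_if)
  next
    case (matching r\<^sub>0 r\<^sub>1 r\<^sub>2 c\<^sub>0 c\<^sub>1 c\<^sub>2)
    thus thesis
      by (intro that[of "[r\<^sub>0, r\<^sub>1, r\<^sub>2]" "[c\<^sub>0, c\<^sub>1, c\<^sub>2]"])
        (simp add: t is_normal_form_def placed_def pattern_def type_def card_insert_if)
  qed
qed

definition edge :: "'v \<times> 'v \<Rightarrow> 'v set" where
  "edge p = {fst p, snd p}"

locale bipartition =
  fixes Rs Cs :: "'v set"
  assumes finite_Rs: "finite Rs" and finite_Cs: "finite Cs" and disjoint: "Rs \<inter> Cs = {}"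
begin

section \<open>Grid points as edges of the complete bipartite graph\<close>

lemma inj_edge: "inj_on edge (Rs \<times> Cs)"
  using disjoint by (auto simp: inj_on_def edge_def doubleton_eq_iff)

lemma Kmm_edges_eq: "Kmm_edges Rs Cs = edge ` (Rs \<times> Cs)"
  unfolding Kmm_edges_def edge_def by (auto simp: image_iff Bex_def) blast+

lemma B_eq: "B Rs Cs X = {p \<in> Rs \<times> Cs. edge p \<in> X}"
  by (auto simp: B_def edge_def)

lemma B_sub: "B Rs Cs X \<subseteq> Rs \<times> Cs"
  by (auto simp: B_eq)

lemma edge_image_B:
  assumes "X \<subseteq> Kmm_edges Rs Cs"
  shows "edge ` B Rs Cs X = X"
  using assms by (auto simp: B_eq Kmm_edges_eq)

lemma B_edge_image:
  assumes "S \<subseteq> Rs \<times> Cs"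
  shows "B Rs Cs (edge ` S) = S"
  using assms inj_on_image_mem_iff[OF inj_edge _ assms] by (auto simp: B_eq)

section \<open>Permutations that keep or exchange the two vertex classes\<close>

definition fixing :: "('v \<Rightarrow> 'v) set" where
  "fixing = {g. g permutes (Rs \<union> Cs) \<and> g ` Rs = Rs \<and> g ` Cs = Cs}"

definition swapping :: "('v \<Rightarrow> 'v) set" where
  "swapping = {g. g permutes (Rs \<union> Cs) \<and> g ` Rs = Cs \<and> g ` Cs = Rs}"

text \<open>One formula for both kinds of permutation: the image pair is reordered so that its row
  comes first. The identity \<open>edge_act\<close> then holds for every \<open>g\<close> and
  \<open>p\<close>, because an edge forgets the order.\<close>

definition act :: "('v \<Rightarrow> 'v) \<Rightarrow> 'v \<times> 'v \<Rightarrow> 'v \<times> 'v" where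
  "act g p = (if g (fst p) \<in> Rs then (g (fst p), g (snd p)) else (g (snd p), g (fst p)))"

lemma act_fixing: "\<lbrakk>g \<in> fixing; p \<in> Rs \<times> Cs\<rbrakk> \<Longrightarrow> act g p = (g (fst p), g (snd p))"
  by (auto simp: act_def fixing_def)

lemma act_swapping: "\<lbrakk>g \<in> swapping; p \<in> Rs \<times> Cs\<rbrakk> \<Longrightarrow> act g p = (g (snd p), g (fst p))"
  using disjoint by (auto simp: act_def swapping_def)

lemma act_mem:
  assumes "g \<in> fixing \<union> swapping" "p \<in> Rs \<times> Cs"
  shows "act g p \<in> Rs \<times> Cs"
  using assms by (auto simp: act_fixing act_swapping) (auto simp: fixing_def swapping_def)

lemma act_image: "g \<in> fixing \<union> swapping \<Longrightarrow> act g ` (Rs \<times> Cs) \<subseteq> Rs \<times> Cs"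
  using act_mem by blast

lemma edge_act: "edge (act g p) = g ` edge p"
  by (auto simp: edge_def act_def)

lemma inj_act:
  assumes "g \<in> fixing \<union> swapping"
  shows "inj_on (act g) (Rs \<times> Cs)"
proof (rule inj_onI)
  fix p q assume pq: "p \<in> Rs \<times> Cs" "q \<in> Rs \<times> Cs" and "act g p = act g q"
  hence "g ` edge p = g ` edge q" using edge_act by metis
  moreover have "inj g" using assms permutes_inj by (auto simp: fixing_def swapping_def)
  ultimately have "edge p = edge q" by (simp add: inj_image_eq_iff)
  thus "p = q" using inj_edge pq by (simp add: inj_on_eq_iff)
qed

text \<open>Both sides are grid points with the same edge, and \<open>edge\<close> is injective on
  the grid; this avoids a case distinction on which factors exchange the classes.\<close>

lemma act_comp:
  assumes "g \<in> fixing \<union> swapping" "h \<in> fixing \<union> swapping" "g \<circ> h \<in> fixing \<union> swapping"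
    and "p \<in> Rs \<times> Cs"
  shows "act (g \<circ> h) p = act g (act h p)"
proof (rule inj_onD[OF inj_edge])
  show "edge (act (g \<circ> h) p) = edge (act g (act h p))" by (simp add: edge_act image_comp)
qed (use assms act_mem in blast)+

text \<open>Translates images of graphs into images of one point set, so that the blocks form an
  orbit in the sense of \<open>class_transitive\<close>.\<close>

lemma B_graph_image:
  assumes "X \<subseteq> Kmm_edges Rs Cs" "g \<in> fixing \<union> swapping"
  shows "B Rs Cs (graph_image g X) = act g ` B Rs Cs X"
proof -
  have "graph_image g X = (\<lambda>e. g ` e) ` edge ` B Rs Cs X"
    using edge_image_B[OF assms(1)] by (simp add: graph_image_def)
  also have "\<dots> = edge ` (act g ` B Rs Cs X)"
    by (simp add: image_image edge_act)
  finally show ?thesis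
    using B_edge_image[of "act g ` B Rs Cs X"] act_mem[OF assms(2)] B_sub[of X]
    by (metis image_subsetI subsetD)
qed

lemma type_act_fixing:
  assumes "g \<in> fixing" "T \<subseteq> Rs \<times> Cs"
  shows "type (act g ` T) = type T"
proof -
  have "fst ` act g ` T = g ` fst ` T" "snd ` act g ` T = g ` snd ` T"
    unfolding image_image using act_fixing[OF assms(1)] assms(2) by (auto intro!: image_cong)
  moreover have "inj g" using assms(1) permutes_inj by (auto simp: fixing_def)
  ultimately show ?thesis unfolding type_def by (simp add: card_image inj_on_subset)
qed

lemma type_act_swapping:
  assumes "g \<in> swapping" "T \<subseteq> Rs \<times> Cs"
  shows "type (act g ` T) = prod.swap (type T)"
proof -
  have "fst ` act g ` T = g ` snd ` T" "snd ` act g ` T = g ` fst ` T"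
    unfolding image_image using act_swapping[OF assms(1)] assms(2) by (auto intro!: image_cong)
  moreover have "inj g" using assms(1) permutes_inj by (auto simp: swapping_def)
  ultimately show ?thesis unfolding type_def by (simp add: card_image inj_on_subset)
qed

lemma fixing_comp: "\<lbrakk>g \<in> fixing; h \<in> fixing\<rbrakk> \<Longrightarrow> g \<circ> h \<in> fixing"
  unfolding fixing_def using permutes_compose
    by (metis (mono_tags, lifting) image_comp mem_Collect_eq)

text \<open>The setwise description is convenient for composites and for types. Conversely, a
  permutation keeping both classes is the composite of its restrictions to them, each extended by
  the identity.\<close>

lemma K_eq: "K Rs Cs = fixing"
proof (intro equalityI subsetI)
  fix g assume "g \<in> K Rs Cs"
  then obtain \<sigma> \<rho> where g: "g = \<sigma> \<circ> \<rho>" and \<sigma>: "\<sigma> permutes Rs" and \<rho>: "\<rho> permutes Cs"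
    by (auto simp: K_def)
  have "\<sigma> permutes (Rs \<union> Cs)" "\<rho> permutes (Rs \<union> Cs)"
    using \<sigma> \<rho> permutes_subset by blast+
  hence "g permutes (Rs \<union> Cs)" unfolding g using permutes_compose by blast
  moreover have "\<rho> ` Rs = Rs" "\<sigma> ` Cs = Cs"
    using \<sigma> \<rho> disjoint permutes_not_in
    by (metis (no_types, lifting) disjoint_iff image_cong image_ident)+
  ultimately show "g \<in> fixing"
    using permutes_image[OF \<sigma>] permutes_image[OF \<rho>]
    unfolding fixing_def g by (metis (mono_tags, lifting) image_comp mem_Collect_eq)
next
  fix g assume g: "g \<in> fixing"
  hence perm: "g permutes (Rs \<union> Cs)" and im: "g ` Rs = Rs" "g ` Cs = Cs" by (auto simp: fixing_def)
  have inj: "inj_on g W" for W using permutes_inj[OF perm] inj_on_subset by blast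
  define \<sigma> where "\<sigma> = (\<lambda>v. if v \<in> Rs then g v else v)"
  define \<rho> where "\<rho> = (\<lambda>v. if v \<in> Cs then g v else v)"
  have "\<sigma> permutes Rs"
    using inj[of Rs] im(1)
    by (intro bij_imp_permutes) (auto simp: \<sigma>_def bij_betw_def cong: inj_on_cong image_cong)
  moreover have "\<rho> permutes Cs"
    using inj[of Cs] im(2)
    by (intro bij_imp_permutes) (auto simp: \<rho>_def bij_betw_def cong: inj_on_cong image_cong)
  moreover have "g = \<sigma> \<circ> \<rho>"
    using im disjoint permutes_not_in[OF perm] by (force simp: \<sigma>_def \<rho>_def fun_eq_iff)
  ultimately show "g \<in> K Rs Cs" by (auto simp: K_def)
qed

lemma fixing_transitive:
  assumes t: "t = 2 \<or> t = 3" and T: "T \<subseteq> Rs \<times> Cs" "T' \<subseteq> Rs \<times> Cs" "card T = t" "card T' = t"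
    and type_eq: "type T = type T'"
  shows "\<exists>g \<in> fixing. act g ` T = T'"
proof -
  obtain rs cs where n: "is_normal_form t T rs cs" using normal_form[OF t T(3)] .
  obtain rs' cs' where n': "is_normal_form t T' rs' cs'" using normal_form[OF t T(4)] .
  note n = n[unfolded is_normal_form_def] and n' = n'[unfolded is_normal_form_def]
  \<comment> \<open>The type records the numbers of rows and columns, hence the lengths of the two
    lists.\<close>
  have len: "length rs = length rs'" "length cs = length cs'"
    using n n' type_eq by (metis distinct_card type_def fst_conv, metis distinct_card type_def snd_conv)
  have sub: "set rs \<subseteq> Rs" "set rs' \<subseteq> Rs" "set cs \<subseteq> Cs" "set cs' \<subseteq> Cs" using n n' T(1,2) by auto
  obtain \<sigma> where \<sigma>: "\<sigma> permutes Rs" "map \<sigma> rs = rs'"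
    using permutes_extend_lists[of Rs rs rs'] finite_Rs n n' len sub by metis
  obtain \<rho> where \<rho>: "\<rho> permutes Cs" "map \<rho> cs = cs'"
    using permutes_extend_lists[of Cs cs cs'] finite_Cs n n' len sub by metis
  let ?g = "\<sigma> \<circ> \<rho>"
  have g: "?g \<in> fixing" using \<sigma> \<rho> K_eq by (auto simp: K_def)
  have act: "act ?g (r, c) = (\<sigma> r, \<rho> c)" if "r \<in> Rs" "c \<in> Cs" for r c
  proof -
    have "\<rho> r = r" "\<rho> c \<in> Cs" "\<sigma> (\<rho> c) = \<rho> c"
      using that \<sigma>(1) \<rho>(1) disjoint permutes_not_in permutes_in_image by (metis disjoint_iff)+
    thus ?thesis using act_fixing[OF g, of "(r, c)"] that by simp
  qed
  have "act ?g ` T = act ?g ` placed rs cs (pattern t (type T))" using n by simp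
  also have "\<dots> = placed rs' cs' (pattern t (type T))"
    unfolding placed_def image_image
  proof (rule image_cong[OF refl], clarify)
    fix i j assume "(i, j) \<in> pattern t (type T)"
    hence "i < length rs" "j < length cs" using n by auto
    thus "act ?g (rs ! i, cs ! j) = (rs' ! i, cs' ! j)"
      using act sub(1,3) \<sigma>(2) \<rho>(2) by (metis nth_map nth_mem subsetD)
  qed
  also have "\<dots> = T'" using n' type_eq by simp
  finally show ?thesis using g by blast
qed

lemma fixing_class_transitive:
  assumes "t = 2 \<or> t = 3"
  shows "class_transitive (Rs \<times> Cs) (act ` fixing) type t"
proof
  fix g h assume "g \<in> act ` fixing" "h \<in> act ` fixing"
  thus "\<exists>f\<in>act ` fixing. \<forall>x\<in>Rs \<times> Cs. f x = g (h x)"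
  proof (clarify)
    fix g h assume gh: "g \<in> fixing" "h \<in> fixing"
    thus "\<exists>f\<in>act ` fixing. \<forall>x\<in>Rs \<times> Cs. f x = act g (act h x)"
      using fixing_comp[OF gh] act_comp[of g h] by (intro bexI[of _ "act (g \<circ> h)"]) auto
  qed
next
  fix T T' :: "('v \<times> 'v) set" assume "T \<subseteq> Rs \<times> Cs" "T' \<subseteq> Rs \<times> Cs" "card T = t" "card T' = t" "type T
    = type T'"
  thus "\<exists>g\<in>act ` fixing. g ` T = T'" using fixing_transitive[OF assms] by blast
qed (use finite_Rs finite_Cs inj_act act_image type_act_fixing in auto)

end

section \<open>Paths and claws\<close>

lemma Collect_less_2: "{f i | i. i < (2::nat)} = {f 0, f 1}"
  by (auto simp: less_2_cases_iff)

lemma Collect_less_3: "{f i | i. i < (3::nat)} = {f 0, f 1, f 2}"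
proof -
  have "i < 3 \<longleftrightarrow> i = 0 \<or> i = 1 \<or> i = 2" for i :: nat by auto
  thus ?thesis by auto
qed

lemma path_edges_2:
  "{{vs ! i, vs ! (i + 1)} | i. i < (2::nat)} = {{vs ! 0, vs ! 1}, {vs ! 1, vs ! 2}}"
  by (rule trans[OF Collect_less_2]) (simp add: numeral_2_eq_2)

lemma path_edges_3:
  "{{vs ! i, vs ! (i + 1)} | i. i < (3::nat)}
    = {{vs ! 0, vs ! 1}, {vs ! 1, vs ! 2}, {vs ! 2, vs ! 3}}"
  by (rule trans[OF Collect_less_3]) (simp add: numeral_2_eq_2 numeral_3_eq_3)

lemma ex_path_2_iff:
  "(\<exists>vs. distinct vs \<and> length vs = 2 + 1 \<and> E = {{vs ! i, vs ! (i + 1)} | i. i < 2})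
    \<longleftrightarrow> (\<exists>u v w. distinct [u, v, w] \<and> E = {{u, v}, {v, w}})" (is "?L \<longleftrightarrow> ?R")
proof
  assume ?L
  then obtain vs where vs: "distinct vs" "length vs = 3" "E = {{vs ! 0, vs ! 1}, {vs ! 1, vs ! 2}}"
    unfolding path_edges_2 by auto
  from vs(2) obtain u v w where "vs = [u, v, w]" by (auto simp: numeral_3_eq_3 length_Suc_conv)
  thus ?R using vs by auto
next
  assume ?R
  then obtain u v w where "distinct [u, v, w]" "E = {{u, v}, {v, w}}" by blast
  thus ?L unfolding path_edges_2 by (intro exI[of _ "[u, v, w]"]) simp
qed

lemma ex_path_3_iff:
  "(\<exists>vs. distinct vs \<and> length vs = 3 + 1 \<and> E = {{vs ! i, vs ! (i + 1)} | i. i < 3})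
    \<longleftrightarrow> (\<exists>u v w x. distinct [u, v, w, x] \<and> E = {{u, v}, {v, w}, {w, x}})" (is "?L \<longleftrightarrow> ?R")
proof
  assume ?L
  then obtain vs where vs: "distinct vs" "length vs = Suc 3"
      "E = {{vs ! 0, vs ! 1}, {vs ! 1, vs ! 2}, {vs ! 2, vs ! 3}}"
    unfolding path_edges_3 by auto
  from vs(2) obtain u v w x where "vs = [u, v, w, x]" by (auto simp: numeral_3_eq_3 length_Suc_conv)
  thus ?R using vs by auto
next
  assume ?R
  then obtain u v w x where "distinct [u, v, w, x]" "E = {{u, v}, {v, w}, {w, x}}" by blast
  thus ?L unfolding path_edges_3 by (intro exI[of _ "[u, v, w, x]"]) simp
qed

context bipartition
begin

text \<open>Since \<open>edge\<close> is injective on the grid, subgraphs of \<open>X\<close>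
  correspond to subsets of its block, whatever property \<open>\<Phi>\<close> selects.\<close>

lemma card_subgraphs:
  assumes "X \<subseteq> Kmm_edges Rs Cs"
  shows "card {E. E \<subseteq> X \<and> \<Phi> E} = card {T. T \<subseteq> B Rs Cs X \<and> \<Phi> (edge ` T)}"
proof -
  let ?S = "B Rs Cs X"
  have inj: "inj_on edge ?S" using inj_edge B_sub inj_on_subset by blast
  have "{E. E \<subseteq> X \<and> \<Phi> E} = (`) edge ` {T. T \<subseteq> ?S \<and> \<Phi> (edge ` T)}"
  proof (intro equalityI subsetI)
    fix E assume E: "E \<in> {E. E \<subseteq> X \<and> \<Phi> E}"
    hence "edge ` B Rs Cs E = E" using edge_image_B assms by blast
    moreover have "B Rs Cs E \<subseteq> ?S" using E by (auto simp: B_eq)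
    ultimately show "E \<in> (`) edge ` {T. T \<subseteq> ?S \<and> \<Phi> (edge ` T)}"
      using E by (intro image_eqI[of _ _ "B Rs Cs E"]) auto
  next
    fix E assume "E \<in> (`) edge ` {T. T \<subseteq> ?S \<and> \<Phi> (edge ` T)}"
    then obtain T where "T \<subseteq> ?S" "\<Phi> (edge ` T)" "E = edge ` T" by blast
    thus "E \<in> {E. E \<subseteq> X \<and> \<Phi> E}" by (auto simp: B_eq)
  qed
  moreover have "inj_on ((`) edge) {T. T \<subseteq> ?S \<and> \<Phi> (edge ` T)}"
    using inj_on_image_Pow[OF inj] by (rule inj_on_subset) auto
  ultimately show ?thesis by (simp add: card_image)
qed

lemma edge_image_mem:
  assumes "T \<subseteq> Rs \<times> Cs" "{u, v} \<in> edge ` T"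
  shows "u \<in> Rs \<and> v \<in> Cs \<or> v \<in> Rs \<and> u \<in> Cs"
  using assms by (auto simp: edge_def doubleton_eq_iff)

lemma edge_image_eqD:
  assumes "edge ` T = edge ` T'" "T \<subseteq> Rs \<times> Cs" "T' \<subseteq> Rs \<times> Cs"
  shows "T = T'"
  using assms by (simp add: inj_on_image_eq_iff[OF inj_edge])

text \<open>The side of the middle vertex decides the case: a middle row vertex gives two points in
  one row, a middle column vertex two points in one column.\<close>

lemma edge_image_2_path_iff:
  assumes T: "T \<subseteq> Rs \<times> Cs"
  shows "(\<exists>u v w. distinct [u, v, w] \<and> edge ` T = {{u, v}, {v, w}})
    \<longleftrightarrow> card T = 2 \<and> (card (fst ` T) = 1 \<or> card (snd ` T) = 1)" (is "?L \<longleftrightarrow> ?R")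
proof
  assume ?L
  then obtain u v w where d: "distinct [u, v, w]" and eq: "edge ` T = {{u, v}, {v, w}}"
    by (elim exE conjE) (rule that)
  have m: "u \<in> Rs \<and> v \<in> Cs \<or> v \<in> Rs \<and> u \<in> Cs" "v \<in> Rs \<and> w \<in> Cs \<or> w \<in> Rs \<and> v \<in> Cs"
    using edge_image_mem[OF T] eq by auto
  show ?R
  proof (cases "v \<in> Rs")
    case True
    hence "u \<in> Cs" "w \<in> Cs" using m disjoint by auto
    hence "T = {(v, u), (v, w)}"
      using True eq by (intro edge_image_eqD[OF _ T]) (auto simp: edge_def insert_commute)
    thus ?thesis using d by (auto simp: card_insert_if)
  next
    case False
    hence "u \<in> Rs" "v \<in> Cs" "w \<in> Rs" using m by auto
    hence "T = {(u, v), (w, v)}"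
      using eq by (intro edge_image_eqD[OF _ T]) (auto simp: edge_def insert_commute)
    thus ?thesis using d by (auto simp: card_insert_if)
  qed
next
  assume R: ?R
  hence "card T = 2" by blast
  thus ?L
  proof (cases rule: card_2_pairs_cases)
    case (row r c\<^sub>0 c\<^sub>1)
    hence "r \<in> Rs" "c\<^sub>0 \<in> Cs" "c\<^sub>1 \<in> Cs" using T by auto
    thus ?thesis using row disjoint
      by (intro exI[of _ c\<^sub>0] exI[of _ r] exI[of _ c\<^sub>1]) (auto simp: edge_def)
  next
    case (column c r\<^sub>0 r\<^sub>1)
    hence "c \<in> Cs" "r\<^sub>0 \<in> Rs" "r\<^sub>1 \<in> Rs" using T by auto
    thus ?thesis using column disjoint
      by (intro exI[of _ r\<^sub>0] exI[of _ c] exI[of _ r\<^sub>1]) (auto simp: edge_def)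
  next
    case matching
    thus ?thesis using R by (auto simp: card_insert_if)
  qed
qed

lemma edge_image_claw_iff:
  assumes T: "T \<subseteq> Rs \<times> Cs"
  shows "(\<exists>z a b c. distinct [z, a, b, c] \<and> edge ` T = {{z, a}, {z, b}, {z, c}})
    \<longleftrightarrow> card T = 3 \<and> (card (fst ` T) = 1 \<or> card (snd ` T) = 1)" (is "?L \<longleftrightarrow> ?R")
proof
  assume ?L
  then obtain z a b c where d: "distinct [z, a, b, c]" and eq: "edge ` T = {{z, a}, {z, b}, {z, c}}"
    by (elim exE conjE) (rule that)
  have m: "z \<in> Rs \<and> a \<in> Cs \<or> a \<in> Rs \<and> z \<in> Cs" "z \<in> Rs \<and> b \<in> Cs \<or> b \<in> Rs \<and> z \<in> Cs"
    "z \<in> Rs \<and> c \<in> Cs \<or> c \<in> Rs \<and> z \<in> Cs"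
    using edge_image_mem[OF T] eq by auto
  show ?R
  proof (cases "z \<in> Rs")
    case True
    hence "a \<in> Cs" "b \<in> Cs" "c \<in> Cs" using m disjoint by auto
    hence "T = {(z, a), (z, b), (z, c)}"
      using True eq by (intro edge_image_eqD[OF _ T]) (auto simp: edge_def)
    thus ?thesis using d by (auto simp: card_insert_if)
  next
    case False
    hence "a \<in> Rs" "b \<in> Rs" "c \<in> Rs" "z \<in> Cs" using m by auto
    hence "T = {(a, z), (b, z), (c, z)}"
      using eq by (intro edge_image_eqD[OF _ T]) (auto simp: edge_def insert_commute)
    thus ?thesis using d by (auto simp: card_insert_if)
  qed
next
  assume R: ?R
  hence "card T = 3" by blast
  thus ?L
  proof (cases rule: card_3_pairs_cases)
    case (row r c\<^sub>0 c\<^sub>1 c\<^sub>2)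
    hence "r \<in> Rs" "c\<^sub>0 \<in> Cs" "c\<^sub>1 \<in> Cs" "c\<^sub>2 \<in> Cs" using T by auto
    thus ?thesis using row disjoint
      by (intro exI[of _ r] exI[of _ c\<^sub>0] exI[of _ c\<^sub>1] exI[of _ c\<^sub>2]) (auto simp: edge_def)
  next
    case (column c r\<^sub>0 r\<^sub>1 r\<^sub>2)
    hence "c \<in> Cs" "r\<^sub>0 \<in> Rs" "r\<^sub>1 \<in> Rs" "r\<^sub>2 \<in> Rs" using T by auto
    thus ?thesis using column disjoint
      by (intro exI[of _ c] exI[of _ r\<^sub>0] exI[of _ r\<^sub>1] exI[of _ r\<^sub>2]) (auto simp: edge_def insert_commute)
  qed (use R in \<open>auto simp: card_insert_if\<close>)
qed

text \<open>The vertices of a path alternate between the sides, so a 3-path uses two rows and two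
  columns. Conversely, a triple of type (2, 2) consists of three cells of a 2 x 2 square.\<close>

lemma edge_image_3_path_iff:
  assumes T: "T \<subseteq> Rs \<times> Cs"
  shows "(\<exists>u v w x. distinct [u, v, w, x] \<and> edge ` T = {{u, v}, {v, w}, {w, x}})
    \<longleftrightarrow> card T = 3 \<and> type T = (2, 2)" (is "?L \<longleftrightarrow> ?R")
proof
  assume ?L
  then obtain u v w x where d: "distinct [u, v, w, x]" and eq: "edge ` T = {{u, v}, {v, w}, {w, x}}"
    by (elim exE conjE) (rule that)
  have m: "u \<in> Rs \<and> v \<in> Cs \<or> v \<in> Rs \<and> u \<in> Cs" "v \<in> Rs \<and> w \<in> Cs \<or> w \<in> Rs \<and> v \<in> Cs"
    "w \<in> Rs \<and> x \<in> Cs \<or> x \<in> Rs \<and> w \<in> Cs"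
    using edge_image_mem[OF T] eq by auto
  show ?R
  proof (cases "v \<in> Rs")
    case True
    hence "u \<in> Cs" "w \<in> Cs" "x \<in> Rs" using m disjoint by auto
    hence "T = {(v, u), (v, w), (x, w)}"
      using True eq by (intro edge_image_eqD[OF _ T]) (auto simp: edge_def insert_commute)
    thus ?thesis using d by (auto simp: type_def card_insert_if)
  next
    case False
    hence "u \<in> Rs" "v \<in> Cs" "w \<in> Rs" "x \<in> Cs" using m disjoint by auto
    hence "T = {(u, v), (w, v), (w, x)}"
      using eq by (intro edge_image_eqD[OF _ T]) (auto simp: edge_def insert_commute)
    thus ?thesis using d by (auto simp: type_def card_insert_if)
  qed
next
  assume R: ?R
  hence "card T = 3" by blast
  thus ?L
  proof (cases rule: card_3_pairs_cases)
    case (path r\<^sub>0 r\<^sub>1 c\<^sub>0 c\<^sub>1)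
    hence "r\<^sub>0 \<in> Rs" "r\<^sub>1 \<in> Rs" "c\<^sub>0 \<in> Cs" "c\<^sub>1 \<in> Cs" using T by auto
    \<comment> \<open>The corner (\<open>r\<^sub>0\<close>, \<open>c\<^sub>0\<close>) becomes the
      middle edge, and the two ends are the other column and the other row.\<close>
    hence "distinct [c\<^sub>1, r\<^sub>0, c\<^sub>0, r\<^sub>1]" using path(1,2) disjoint by auto
    moreover have "edge ` T = {{c\<^sub>1, r\<^sub>0}, {r\<^sub>0, c\<^sub>0}, {c\<^sub>0, r\<^sub>1}}"
      unfolding path(3) by (simp add: edge_def insert_commute)
    ultimately show ?thesis by (intro exI conjI)
  qed (use R in \<open>auto simp: type_def card_insert_if\<close>)
qed

lemma finite_B: "finite (B Rs Cs X)"
  using finite_Rs finite_Cs B_sub finite_subset by blast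

text \<open>A set inside one row and one column has at most one point, so for t at least 2 the two
  alternatives exclude each other.\<close>

lemma card_collinear:
  assumes "t \<ge> 2" "finite S"
  shows "card {T. T \<subseteq> S \<and> card T = t \<and> (card (fst ` T) = 1 \<or> card (snd ` T) = 1)}
    = subset_count t fst 1 S + subset_count t snd 1 S"
proof -
  have "False" if "card T = t" "card (fst ` T) = 1" "card (snd ` T) = 1" for T :: "('a \<times> 'b) set"
  proof -
    obtain r c where "fst ` T = {r}" "snd ` T = {c}" using \<open>card (fst ` T) = 1\<close> \<open>card (snd ` T) = 1\<close>
      by (auto simp: card_1_singleton_iff)
    hence "T \<subseteq> {r} \<times> {c}" by (auto simp: subset_fst_snd dest: subsetD[OF subset_fst_snd])
    hence "card T \<le> card ({r} \<times> {c})" by (intro card_mono) auto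
    thus False using that assms(1) by simp
  qed
  hence "{T. T \<subseteq> S \<and> card T = t \<and> card (fst ` T) = 1}
      \<inter> {T. T \<subseteq> S \<and> card T = t \<and> card (snd ` T) = 1} = {}" by blast
  moreover have "{T. T \<subseteq> S \<and> card T = t \<and> (card (fst ` T) = 1 \<or> card (snd ` T) = 1)}
    = {T. T \<subseteq> S \<and> card T = t \<and> card (fst ` T) = 1}
      \<union> {T. T \<subseteq> S \<and> card T = t \<and> card (snd ` T) = 1}" by blast
  ultimately show ?thesis
    using assms(2) by (simp add: subset_count_def card_Un_disjoint)
qed

lemma card_paths_2:
  assumes "X \<subseteq> Kmm_edges Rs Cs"
  shows "card (paths 2 X) = subset_count 2 fst 1 (B Rs Cs X) + subset_count 2 snd 1 (B Rs Cs X)"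
proof -
  have "card (paths 2 X) = card {T. T \<subseteq> B Rs Cs X \<and>
      (\<exists>u v w. distinct [u, v, w] \<and> edge ` T = {{u, v}, {v, w}})}"
    unfolding paths_def ex_path_2_iff by (rule card_subgraphs[OF assms])
  also have "\<dots> = card {T. T \<subseteq> B Rs Cs X \<and> card T = 2 \<and> (card (fst ` T) = 1 \<or> card (snd ` T) = 1)}"
    using edge_image_2_path_iff B_sub
      by (intro arg_cong[of _ _ card] Collect_cong) (meson order.trans)
  also have "\<dots> = subset_count 2 fst 1 (B Rs Cs X) + subset_count 2 snd 1 (B Rs Cs X)"
    by (rule card_collinear) (simp_all add: finite_B)
  finally show ?thesis .
qed

lemma card_claws3:
  assumes "X \<subseteq> Kmm_edges Rs Cs"
  shows "card (claws3 X) = subset_count 3 fst 1 (B Rs Cs X) + subset_count 3 snd 1 (B Rs Cs X)"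
proof -
  have "card (claws3 X) = card {T. T \<subseteq> B Rs Cs X \<and>
      (\<exists>z a b c. distinct [z, a, b, c] \<and> edge ` T = {{z, a}, {z, b}, {z, c}})}"
    unfolding claws3_def by (rule card_subgraphs[OF assms])
  also have "\<dots> = card {T. T \<subseteq> B Rs Cs X \<and> card T = 3 \<and> (card (fst ` T) = 1 \<or> card (snd ` T) = 1)}"
    using edge_image_claw_iff B_sub
      by (intro arg_cong[of _ _ card] Collect_cong) (meson order.trans)
  also have "\<dots> = subset_count 3 fst 1 (B Rs Cs X) + subset_count 3 snd 1 (B Rs Cs X)"
    by (rule card_collinear) (simp_all add: finite_B)
  finally show ?thesis .
qed

lemma card_paths_3:
  assumes "X \<subseteq> Kmm_edges Rs Cs"
  shows "card (paths 3 X) = type_count 3 (2, 2) (B Rs Cs X)"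
proof -
  have "card (paths 3 X) = card {T. T \<subseteq> B Rs Cs X \<and>
      (\<exists>u v w x. distinct [u, v, w, x] \<and> edge ` T = {{u, v}, {v, w}, {w, x}})}"
    unfolding paths_def ex_path_3_iff by (rule card_subgraphs[OF assms])
  also have "\<dots> = card {T. T \<subseteq> B Rs Cs X \<and> card T = 3 \<and> type T = (2, 2)}"
    using edge_image_3_path_iff B_sub
      by (intro arg_cong[of _ _ card] Collect_cong) (meson order.trans)
  finally show ?thesis by (simp add: type_count_def)
qed

lemma degree_row:
  assumes "X \<subseteq> Kmm_edges Rs Cs" "r \<in> Rs"
  shows "degree X r = card {p \<in> B Rs Cs X. fst p = r}"
proof -
  have "{e \<in> X. r \<in> e} = edge ` {p \<in> B Rs Cs X. r \<in> edge p}"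
    by (subst edge_image_B[OF assms(1), symmetric]) auto
  also have "{p \<in> B Rs Cs X. r \<in> edge p} = {p \<in> B Rs Cs X. fst p = r}"
    using assms(2) disjoint by (auto simp: B_eq edge_def)
  finally have "{e \<in> X. r \<in> e} = edge ` {p \<in> B Rs Cs X. fst p = r}" .
  moreover have "inj_on edge {p \<in> B Rs Cs X. fst p = r}"
    using inj_edge by (rule inj_on_subset) (auto simp: B_eq)
  ultimately show ?thesis by (simp add: degree_def card_image)
qed

lemma degree_column:
  assumes "X \<subseteq> Kmm_edges Rs Cs" "c \<in> Cs"
  shows "degree X c = card {p \<in> B Rs Cs X. snd p = c}"
proof -
  have "{e \<in> X. c \<in> e} = edge ` {p \<in> B Rs Cs X. c \<in> edge p}"
    by (subst edge_image_B[OF assms(1), symmetric]) auto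
  also have "{p \<in> B Rs Cs X. c \<in> edge p} = {p \<in> B Rs Cs X. snd p = c}"
    using assms(2) disjoint by (auto simp: B_eq edge_def)
  finally have "{e \<in> X. c \<in> e} = edge ` {p \<in> B Rs Cs X. snd p = c}" .
  moreover have "inj_on edge {p \<in> B Rs Cs X. snd p = c}"
    using inj_edge by (rule inj_on_subset) (auto simp: B_eq)
  ultimately show ?thesis by (simp add: degree_def card_image)
qed

end

section \<open>The groups \<open>K\<close> and \<open>G\<close>\<close>

lemma group_Sym: "group (Sym V)"
proof (rule groupI)
  fix p assume "p \<in> carrier (Sym V)"
  hence "p permutes V" by (simp add: Sym_def)
  thus "\<exists>q\<in>carrier (Sym V). q \<otimes>\<^bsub>Sym V\<^esub> p = \<one>\<^bsub>Sym V\<^esub>"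
    using permutes_inv[of p V] permutes_inv_o(2)[of p V] by (auto simp: Sym_def)
qed (auto simp: Sym_def permutes_compose permutes_id comp_assoc)

text \<open>Induction over \<open>generate\<close> produces inverses in the group record; this turns
  them into inverse functions.\<close>

lemma inv_Sym:
  assumes "p permutes V"
  shows "inv\<^bsub>Sym V\<^esub> p = inv_into UNIV p"
proof (rule group.inv_equality[OF group_Sym])
  show "inv_into UNIV p \<otimes>\<^bsub>Sym V\<^esub> p = \<one>\<^bsub>Sym V\<^esub>"
    using permutes_inv_o(2)[OF assms] by (simp add: Sym_def)
qed (use assms permutes_inv in \<open>auto simp: Sym_def\<close>)

context bipartition
begin

lemma id_fixing: "id \<in> fixing"
  using permutes_id by (auto simp: fixing_def)

lemma bipartition_preserving_comp:
  assumes "g \<in> fixing \<union> swapping" "h \<in> fixing \<union> swapping"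
  shows "g \<circ> h \<in> fixing \<union> swapping"
proof -
  have perm: "g permutes (Rs \<union> Cs)" "h permutes (Rs \<union> Cs)"
    and im: "g ` Rs = Rs \<and> g ` Cs = Cs \<or> g ` Rs = Cs \<and> g ` Cs = Rs"
      "h ` Rs = Rs \<and> h ` Cs = Cs \<or> h ` Rs = Cs \<and> h ` Cs = Rs"
    using assms by (auto simp: fixing_def swapping_def)
  have "(g \<circ> h) permutes (Rs \<union> Cs)" using perm permutes_compose by blast
  moreover have "(g \<circ> h) ` Rs = g ` h ` Rs" "(g \<circ> h) ` Cs = g ` h ` Cs"
    by (simp_all only: image_comp)
  ultimately show ?thesis
    using im unfolding fixing_def swapping_def by (elim disjE) simp_all
qed

lemma bipartition_preserving_inv:
  assumes "g \<in> fixing \<union> swapping"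
  shows "inv_into UNIV g \<in> fixing \<union> swapping"
proof -
  have perm: "g permutes (Rs \<union> Cs)"
    and im: "g ` Rs = Rs \<and> g ` Cs = Cs \<or> g ` Rs = Cs \<and> g ` Cs = Rs"
    using assms by (auto simp: fixing_def swapping_def)
  have "inv_into UNIV g ` g ` W = W" for W
    using permutes_inj[OF perm] by (simp add: image_inv_f_f)
  from this[of Rs] this[of Cs] show ?thesis
    using im permutes_inv[OF perm] unfolding fixing_def swapping_def by (elim disjE) auto
qed

text \<open>The union of \<open>fixing\<close> and \<open>swapping\<close> contains the identity and
  is closed under composition and inverses, so it bounds every group generated inside it.\<close>

lemma generate_sub:
  assumes "H \<subseteq> fixing \<union> swapping" "g \<in> generate (Sym (Rs \<union> Cs)) H"
  shows "g \<in> fixing \<union> swapping"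
  using assms(2)
proof (induction rule: generate.induct)
  case one
  show ?case using id_fixing unfolding Sym_def by (metis UnI1 monoid.select_convs(2))
next
  case (incl h)
  thus ?case using assms(1) by blast
next
  case (inv h)
  hence h: "h \<in> fixing \<union> swapping" using assms(1) by blast
  hence "h permutes (Rs \<union> Cs)" by (auto simp: fixing_def swapping_def)
  thus ?case using bipartition_preserving_inv[OF h] by (simp add: inv_Sym)
next
  case (eng g h)
  have "g \<otimes>\<^bsub>Sym (Rs \<union> Cs)\<^esub> h = g \<circ> h" by (simp add: Sym_def)
  thus ?case using bipartition_preserving_comp[OF eng.IH] by (simp only:)
qed

section \<open>Design criteria for K and for larger groups\<close>

lemma orbit_structure_eq:
  assumes "H \<subseteq> fixing \<union> swapping" "X \<subseteq> Kmm_edges Rs Cs"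
  shows "orbit_structure H Rs Cs X = (Rs \<times> Cs, {g ` B Rs Cs X | g. g \<in> act ` H})"
proof -
  have "{B Rs Cs (graph_image g X) | g. g \<in> H} = (\<lambda>g. B Rs Cs (graph_image g X)) ` H" by blast
  also have "\<dots> = (\<lambda>g. act g ` B Rs Cs X) ` H"
    using B_graph_image[OF assms(2)] assms(1) by (intro image_cong) blast+
  also have "\<dots> = {g ` B Rs Cs X | g. g \<in> act ` H}" by blast
  finally show ?thesis by (simp add: orbit_structure_def)
qed

lemma act_id_B: "act id ` B Rs Cs X = B Rs Cs X"
proof -
  have "act id p = p" if "p \<in> Rs \<times> Cs" for p
    using act_fixing[OF id_fixing that] by simp
  thus ?thesis using B_sub by force
qed

lemma t_design_fixing_iff:
  assumes "t = 2 \<or> t = 3" "X \<subseteq> Kmm_edges Rs Cs" "t \<le> card (B Rs Cs X)"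
  shows "t_design t (orbit_structure (K Rs Cs) Rs Cs X) \<longleftrightarrow>
    (\<forall>c. type_count t c (B Rs Cs X) * (card (Rs \<times> Cs) choose t)
      = (card (B Rs Cs X) choose t) * type_count t c (Rs \<times> Cs))"
proof -
  interpret class_transitive "Rs \<times> Cs" "act ` fixing" type t
    by (rule fixing_class_transitive[OF assms(1)])
  have orb: "\<exists>g\<in>act ` fixing. g ` B Rs Cs X = B Rs Cs X"
    using id_fixing act_id_B by blast
  have "orbit_structure (K Rs Cs) Rs Cs X = (Rs \<times> Cs, blocks (B Rs Cs X))"
    unfolding K_eq blocks_def[OF B_sub orb] using assms(2) by (intro orbit_structure_eq) auto
  thus ?thesis
    using t_design_iff[OF B_sub orb] assms(1,3) by (auto simp: type_count_def cls_def)
qed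

text \<open>The unordered pair is a set, so equal entries collapse: {2} stands for (2, 2) and {3}
  for (3, 3).\<close>

definition unordered_type :: "('v \<times> 'v) set \<Rightarrow> nat set" where
  "unordered_type T = {fst (type T), snd (type T)}"

text \<open>Here \<open>H\<close> abstracts G: it lies between \<open>fixing\<close> and its union
  with \<open>swapping\<close>, and contains some exchange \<open>s\<close>. Sets of one type are
  already related by \<open>fixing\<close>; for opposite types \<open>s\<close> is applied
  first.\<close>

lemma full_class_transitive:
  assumes t: "t = 2 \<or> t = 3" and H: "fixing \<subseteq> H" "H \<subseteq> fixing \<union> swapping"
    and s: "s \<in> H" "s \<in> swapping" and comp: "\<And>g h. g \<in> H \<Longrightarrow> h \<in> H \<Longrightarrow> g \<circ> h \<in> H"
  shows "class_transitive (Rs \<times> Cs) (act ` H) unordered_type t"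
proof
  have closed: "\<exists>f\<in>act ` H. \<forall>x\<in>Rs \<times> Cs. f x = act g (act h x)" if "g \<in> H" "h \<in> H" for g h
  proof -
    have "g \<circ> h \<in> H" using comp that by blast
    moreover from this have "\<forall>x\<in>Rs \<times> Cs. act (g \<circ> h) x = act g (act h x)"
      using act_comp[of g h] H(2) that by blast
    ultimately show ?thesis by blast
  qed
  show "\<exists>f\<in>act ` H. \<forall>x\<in>Rs \<times> Cs. f x = g (h x)" if "g \<in> act ` H" "h \<in> act ` H" for g h
    using closed that by blast
  show "inj_on g (Rs \<times> Cs)" if "g \<in> act ` H" for g using that inj_act H(2) by blast
  show "g ` (Rs \<times> Cs) \<subseteq> Rs \<times> Cs" if "g \<in> act ` H" for g using that act_image H(2) by blast
  show "finite (Rs \<times> Cs)" using finite_Rs finite_Cs by simp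
  show "unordered_type (g ` T) = unordered_type T"
    if g: "g \<in> act ` H" and T: "T \<subseteq> Rs \<times> Cs" for g T
  proof -
    obtain h where h: "g = act h" "h \<in> fixing \<union> swapping" using g H(2) by blast
    thus ?thesis
      using type_act_fixing[OF _ T, of h] type_act_swapping[OF _ T, of h]
      by (auto simp: unordered_type_def)
  qed
  show "\<exists>g\<in>act ` H. g ` T = T'"
    if T: "T \<subseteq> Rs \<times> Cs" "T' \<subseteq> Rs \<times> Cs" "card T = t" "card T' = t"
      and eq: "unordered_type T = unordered_type T'" for T T'
  proof (cases "type T = type T'")
    case True
    thus ?thesis using fixing_transitive[OF t T] H(1) by blast
  next
    case False
    \<comment> \<open>The types differ but agree as unordered pairs, so they are transposes of each
      other; \<open>s\<close> transposes the type of \<open>T\<close>, and an element of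
      \<open>fixing\<close> does the rest.\<close>
    have sT: "act s ` T \<subseteq> Rs \<times> Cs" using act_mem[of s] s(2) T(1) by blast
    have "card (act s ` T) = card T"
      using inj_act[of s] s(2) T(1) inj_on_subset by (intro card_image) blast
    moreover have "type (act s ` T) = type T'"
      using type_act_swapping[OF s(2) T(1)] eq False
      by (cases "type T"; cases "type T'") (auto simp: unordered_type_def doubleton_eq_iff)
    ultimately obtain g where g: "g \<in> fixing" "act g ` act s ` T = T'"
      using fixing_transitive[OF t sT T(2)] T(3,4) by auto
    obtain f where f: "f \<in> act ` H" "\<forall>x\<in>Rs \<times> Cs. f x = act g (act s x)"
      using closed[of g s] g(1) H(1) s(1) by blast
    have "f ` T = act g ` act s ` T" unfolding image_image using f(2) T(1)
      by (intro image_cong) auto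
    thus ?thesis using f(1) g(2) by blast
  qed
qed

lemma t_design_full_iff:
  assumes t: "t = 2 \<or> t = 3" and H: "fixing \<subseteq> H" "H \<subseteq> fixing \<union> swapping"
    and s: "s \<in> H" "s \<in> swapping" and comp: "\<And>g h. g \<in> H \<Longrightarrow> h \<in> H \<Longrightarrow> g \<circ> h \<in> H"
    and X: "X \<subseteq> Kmm_edges Rs Cs" "t \<le> card (B Rs Cs X)"
  shows "t_design t (orbit_structure H Rs Cs X) \<longleftrightarrow>
    (\<forall>c. card {T. T \<subseteq> B Rs Cs X \<and> card T = t \<and> {fst (type T), snd (type T)} = c}
        * (card (Rs \<times> Cs) choose t)
      = (card (B Rs Cs X) choose t)
        * card {T. T \<subseteq> Rs \<times> Cs \<and> card T = t \<and> {fst (type T), snd (type T)} = c})"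
proof -
  interpret class_transitive "Rs \<times> Cs" "act ` H" unordered_type t
    by (rule full_class_transitive[OF t H s comp])
  have orb: "\<exists>g\<in>act ` H. g ` B Rs Cs X = B Rs Cs X"
    using id_fixing act_id_B H(1) by blast
  have "orbit_structure H Rs Cs X = (Rs \<times> Cs, blocks (B Rs Cs X))"
    unfolding blocks_def[OF B_sub orb] by (rule orbit_structure_eq[OF H(2) X(1)])
  thus ?thesis
    using t_design_iff[OF B_sub orb] t X(2) by (auto simp: cls_def unordered_type_def)
qed

end

section \<open>The exchange of rows and columns\<close>

lemma tau_swap:
  assumes "inj_on R {1..m}" "inj_on C {1..m}" "R ` {1..m} \<inter> C ` {1..m} = {}" "i \<in> {1..m}"
  shows "tau m R C (R i) = C i" "tau m R C (C i) = R i"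
proof -
  show "tau m R C (R i) = C i" using assms by (simp add: tau_def)
  have "C i \<notin> R ` {1..m}" using assms(3,4) by blast
  thus "tau m R C (C i) = R i" using assms by (simp add: tau_def)
qed

lemma tau_swapping:
  assumes "inj_on R {1..m}" "inj_on C {1..m}" "R ` {1..m} \<inter> C ` {1..m} = {}"
  shows "tau m R C permutes (R ` {1..m} \<union> C ` {1..m})"
    and "tau m R C ` R ` {1..m} = C ` {1..m}" and "tau m R C ` C ` {1..m} = R ` {1..m}"
proof -
  note sw = tau_swap[OF assms]
  show im: "tau m R C ` R ` {1..m} = C ` {1..m}" "tau m R C ` C ` {1..m} = R ` {1..m}"
    unfolding image_image using sw by (auto intro!: image_cong)
  have outside: "tau m R C v = v" if "v \<notin> R ` {1..m} \<union> C ` {1..m}" for v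
    using that by (auto simp: tau_def)
  \<comment> \<open>An involution is its own inverse, which yields the unique preimages demanded by
    \<open>permutes\<close>.\<close>
  have invol: "tau m R C (tau m R C v) = v" for v
    using sw outside by (cases "v \<in> R ` {1..m} \<union> C ` {1..m}") auto
  show "tau m R C permutes (R ` {1..m} \<union> C ` {1..m})"
    unfolding permutes_def using outside invol by metis
qed

section \<open>Balance conditions\<close>

lemma real_choose_2: "real (n choose 2) = real n * (real n - 1) / 2"
proof (induction n)
  case (Suc n)
  thus ?case by (simp add: numeral_2_eq_2 field_simps)
qed (simp add: numeral_2_eq_2)

lemma real_choose_3: "real (n choose 3) = real n * (real n - 1) * (real n - 2) / 6"
proof (induction n)
  case (Suc n)
  have "real (Suc n choose 3) = real (n choose 2) + real (n choose 3)"
    by (simp add: numeral_3_eq_3 numeral_2_eq_2)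
  thus ?case unfolding real_choose_2 Suc by (simp add: field_simps)
qed (simp add: numeral_3_eq_3)

text \<open>In this and the next two lemmas the left side counts row pairs, row triples and 3-paths
  of the grid, and the right side is their share times the number of all pairs or triples. The
  factor m - 1 cancels against m^2 - 1.\<close>

lemma ratio_2:
  fixes m :: real
  assumes "m \<ge> 3"
  shows "m * (m * (m - 1) / 2) = 1 / (m + 1) * (m\<^sup>2 * (m\<^sup>2 - 1) / 2)"
  using assms by (simp add: field_simps power2_eq_square)

lemma ratio_claw:
  fixes m :: real
  assumes "m \<ge> 3"
  shows "m * (m * (m - 1) * (m - 2) / 6)
    = (m - 2) / ((m + 1) * (m\<^sup>2 - 2)) * (m\<^sup>2 * (m\<^sup>2 - 1) * (m\<^sup>2 - 2) / 6)"
proof -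
  have "m\<^sup>2 \<ge> 3\<^sup>2" using assms by (intro power_mono) auto
  hence "m\<^sup>2 - 2 \<noteq> 0" "m + 1 \<noteq> 0" using assms by auto
  moreover have "m\<^sup>2 - 1 = (m - 1) * (m + 1)" by (simp add: power2_eq_square algebra_simps)
  ultimately show ?thesis by (simp add: power2_eq_square)
qed

lemma ratio_path:
  fixes m :: real
  assumes "m \<ge> 3"
  shows "(m * (m - 1))\<^sup>2
    = 6 * (m - 1) / ((m + 1) * (m\<^sup>2 - 2)) * (m\<^sup>2 * (m\<^sup>2 - 1) * (m\<^sup>2 - 2) / 6)"
proof -
  have "m\<^sup>2 \<ge> 3\<^sup>2" using assms by (intro power_mono) auto
  hence "m\<^sup>2 - 2 \<noteq> 0" "m + 1 \<noteq> 0" using assms by auto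
  moreover have "m\<^sup>2 - 1 = (m - 1) * (m + 1)" by (simp add: power2_eq_square algebra_simps)
  ultimately show ?thesis by (simp add: power2_eq_square)
qed

text \<open>With \<open>\<rho>\<close> the share of a class among all \<open>V\<close> t-sets of the
  grid, the cross-multiplied condition says that the block attains the expected number of class
  members.\<close>

lemma balanced_iff:
  fixes N V k N' :: nat and \<rho> :: real
  assumes "V > 0" "real N' = \<rho> * real V"
  shows "N * V = k * N' \<longleftrightarrow> real N = real k * \<rho>"
proof -
  have "N * V = k * N' \<longleftrightarrow> real N * real V = real k * \<rho> * real V"
    using assms(2) by (metis mult.assoc of_nat_eq_iff of_nat_mult)
  thus ?thesis using assms(1) by simp
qed

text \<open>Rewrites the constants of the theorem as a binomial coefficient in k times a share, with
  A standing for k(k-1) or k(k-1)(k-2).\<close>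

lemma quotient_identities:
  fixes A n a b :: real
  shows "A / (2 * a) = A / 2 * (1 / a)" "A / a = 2 * (A / 2 * (1 / a))"
    "A * n / (6 * a * b) = A / 6 * (n / (a * b))"
    "A * n / (3 * a * b) = 2 * (A / 6 * (n / (a * b)))"
    "A * n / (a * b) = A / 6 * (6 * n / (a * b))"
  by (simp_all add: divide_simps)

section \<open>Restricting balance to the classes that occur\<close>

lemma all_iff_ball:
  assumes "\<And>c. c \<notin> A \<Longrightarrow> Q c"
  shows "(\<forall>c. Q c) \<longleftrightarrow> (\<forall>c\<in>A. Q c)"
  using assms by blast

lemma all_types\<^sub>2_iff:
  fixes X P :: "('a \<times> 'b) set"
  shows "(\<forall>c. type_count 2 c X * n = k * type_count 2 c P) \<longleftrightarrow>
    (\<forall>c\<in>types\<^sub>2. type_count 2 c X * n = k * type_count 2 c P)"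
proof -
  have zero: "type_count 2 c Y = 0" if "c \<notin> types\<^sub>2" for c and Y :: "('a \<times> 'b) set"
  proof -
    have "{T. T \<subseteq> Y \<and> card T = 2 \<and> type T = c} = {}" using type_in_types\<^sub>2 that by blast
    thus ?thesis by (simp only: type_count_def card.empty)
  qed
  have "type_count 2 c X * n = k * type_count 2 c P" if "c \<notin> types\<^sub>2" for c
    unfolding zero[OF that] by simp
  thus ?thesis by (rule all_iff_ball)
qed

lemma all_types\<^sub>3_iff:
  fixes X P :: "('a \<times> 'b) set"
  shows "(\<forall>c. type_count 3 c X * n = k * type_count 3 c P) \<longleftrightarrow>
    (\<forall>c\<in>types\<^sub>3. type_count 3 c X * n = k * type_count 3 c P)"
proof -
  have zero: "type_count 3 c Y = 0" if "c \<notin> types\<^sub>3" for c and Y :: "('a \<times> 'b) set"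
  proof -
    have "{T. T \<subseteq> Y \<and> card T = 3 \<and> type T = c} = {}" using type_in_types\<^sub>3 that by blast
    thus ?thesis by (simp only: type_count_def card.empty)
  qed
  have "type_count 3 c X * n = k * type_count 3 c P" if "c \<notin> types\<^sub>3" for c
    unfolding zero[OF that] by simp
  thus ?thesis by (rule all_iff_ball)
qed

lemma unordered_types:
  "{c \<in> types\<^sub>2. {fst c, snd c} = {1, 2}} = {(1, 2), (2, 1)}"
  "{c \<in> types\<^sub>2. {fst c, snd c} = {2}} = {(2, 2)}"
  "{c \<in> types\<^sub>3. {fst c, snd c} = {1, 3}} = {(1, 3), (3, 1)}"
  "{c \<in> types\<^sub>3. {fst c, snd c} = {2}} = {(2, 2)}"
  "{c \<in> types\<^sub>3. {fst c, snd c} = {2, 3}} = {(2, 3), (3, 2)}"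
  "{c \<in> types\<^sub>3. {fst c, snd c} = {3}} = {(3, 3)}"
  by (auto simp: doubleton_eq_iff)

lemma all_unordered_types\<^sub>2_iff:
  fixes X P :: "('a \<times> 'b) set"
  assumes "finite X" "finite P"
  defines "N \<equiv> \<lambda>c Y :: ('a \<times> 'b) set. card {T. T \<subseteq> Y \<and> card T = 2 \<and> {fst (type T), snd (type T)}
    = c}"
  shows "(\<forall>c. N c X * n = k * N c P) \<longleftrightarrow>
    (subset_count 2 fst 1 X + subset_count 2 snd 1 X) * n
      = k * (subset_count 2 fst 1 P + subset_count 2 snd 1 P) \<and>
    type_count 2 (2, 2) X * n = k * type_count 2 (2, 2) P"
proof -
  have N: "N c Y = (\<Sum>d\<in>{d \<in> types\<^sub>2. {fst d, snd d} = c}. type_count 2 d Y)" if "finite Y" for c Y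
    unfolding N_def using that type_in_types\<^sub>2 by (intro sum_type_count_fibre) auto
  have N12: "N {1, 2} Y = subset_count 2 fst 1 Y + subset_count 2 snd 1 Y"
    and N2: "N {2} Y = type_count 2 (2, 2) Y" if "finite Y" for Y
    unfolding N[OF that] unordered_types using type_count_relations(1,2)[OF that] by simp_all
  have N0: "N c Y = 0" if "finite Y" "c \<noteq> {1, 2}" "c \<noteq> {2}" for c Y
  proof -
    have "{d \<in> types\<^sub>2. {fst d, snd d} = c} = {}" using that(2,3) by auto
    thus ?thesis unfolding N[OF that(1)] by (simp only: sum.empty)
  qed
  have "(\<forall>c. N c X * n = k * N c P) \<longleftrightarrow>
      N {1, 2} X * n = k * N {1, 2} P \<and> N {2} X * n = k * N {2} P"
  proof -
    have "N c X * n = k * N c P" if "c \<notin> {{1, 2}, {2}}" for c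
    proof -
      have c: "c \<noteq> {1, 2}" "c \<noteq> {2}" using that by simp_all
      show ?thesis using N0[OF assms(1) c] N0[OF assms(2) c] by (simp only: mult_0 mult_0_right)
    qed
    hence "(\<forall>c. N c X * n = k * N c P) \<longleftrightarrow> (\<forall>c\<in>{{1, 2}, {2}}. N c X * n = k * N c P)"
      by (rule all_iff_ball)
    thus ?thesis by (simp only: ball_simps(5,7) simp_thms)
  qed
  thus ?thesis using N12 N2 assms(1,2) by simp
qed

lemma all_unordered_types\<^sub>3_iff:
  fixes X P :: "('a \<times> 'b) set"
  assumes "finite X" "finite P"
  defines "N \<equiv> \<lambda>c Y :: ('a \<times> 'b) set. card {T. T \<subseteq> Y \<and> card T = 3 \<and> {fst (type T), snd (type T)}
    = c}"
  shows "(\<forall>c. N c X * n = k * N c P) \<longleftrightarrow>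
    (subset_count 3 fst 1 X + subset_count 3 snd 1 X) * n
      = k * (subset_count 3 fst 1 P + subset_count 3 snd 1 P) \<and>
    type_count 3 (2, 2) X * n = k * type_count 3 (2, 2) P \<and>
    (type_count 3 (2, 3) X + type_count 3 (3, 2) X) * n
      = k * (type_count 3 (2, 3) P + type_count 3 (3, 2) P) \<and>
    type_count 3 (3, 3) X * n = k * type_count 3 (3, 3) P"
proof -
  have N: "N c Y = (\<Sum>d\<in>{d \<in> types\<^sub>3. {fst d, snd d} = c}. type_count 3 d Y)" if "finite Y" for c Y
    unfolding N_def using that type_in_types\<^sub>3 by (intro sum_type_count_fibre) auto
  have N13: "N {1, 3} Y = subset_count 3 fst 1 Y + subset_count 3 snd 1 Y"
    and N2: "N {2} Y = type_count 3 (2, 2) Y"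
    and N23: "N {2, 3} Y = type_count 3 (2, 3) Y + type_count 3 (3, 2) Y"
    and N3: "N {3} Y = type_count 3 (3, 3) Y" if "finite Y" for Y
    unfolding N[OF that] unordered_types using type_count_relations(4,5)[OF that] by simp_all
  have N0: "N c Y = 0" if "finite Y" "c \<noteq> {1, 3}" "c \<noteq> {2}" "c \<noteq> {2, 3}" "c \<noteq> {3}" for c Y
  proof -
    have "{d \<in> types\<^sub>3. {fst d, snd d} = c} = {}" using that(2-5) by auto
    thus ?thesis unfolding N[OF that(1)] by (simp only: sum.empty)
  qed
  have "(\<forall>c. N c X * n = k * N c P) \<longleftrightarrow>
      N {1, 3} X * n = k * N {1, 3} P \<and> N {2} X * n = k * N {2} P \<and>
      N {2, 3} X * n = k * N {2, 3} P \<and> N {3} X * n = k * N {3} P"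
  proof -
    have "N c X * n = k * N c P" if "c \<notin> {{1, 3}, {2}, {2, 3}, {3}}" for c
    proof -
      have c: "c \<noteq> {1, 3}" "c \<noteq> {2}" "c \<noteq> {2, 3}" "c \<noteq> {3}" using that by simp_all
      show ?thesis using N0[OF assms(1) c] N0[OF assms(2) c] by (simp only: mult_0 mult_0_right)
    qed
    hence "(\<forall>c. N c X * n = k * N c P) \<longleftrightarrow> (\<forall>c\<in>{{1, 3}, {2}, {2, 3}, {3}}. N c X * n = k * N c P)"
      by (rule all_iff_ball)
    thus ?thesis by (simp only: ball_simps(5,7) simp_thms)
  qed
  thus ?thesis using N13 N2 N23 N3 assms(1,2) by simp
qed

section \<open>Balance of a k-set against a grid given by its counts\<close>

context
  fixes X P :: "('a \<times> 'b) set" and m k :: nat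
  assumes fin: "finite X" "finite P" and m: "m \<ge> 3" and k: "card X = k" "k \<ge> 3"
    and P: "card P = m\<^sup>2" "subset_count 2 fst 1 P = m * (m choose 2)" "subset_count 2 snd 1 P
      = m * (m choose 2)"
      "subset_count 3 fst 1 P = m * (m choose 3)" "subset_count 3 snd 1 P = m * (m choose 3)"
      "type_count 3 (2, 2) P = (m * (m - 1))\<^sup>2"
begin

private definition "V\<^sub>2 = card P choose 2"
private definition "V\<^sub>3 = card P choose 3"
private definition "pair_bal = real (k choose 2) * (1 / (real m + 1))"
private definition "claw_ratio = (real m - 2) / ((real m + 1) * ((real m)\<^sup>2 - 2))"
private definition "path_ratio = 6 * (real m - 1) / ((real m + 1) * ((real m)\<^sup>2 - 2))"
text \<open>The share of the type (2, 3), obtained by solving the pair-triple relation of the grid;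
  \<open>matching_ratio\<close> is what remains from the total. The factor 3 reflects that a triple
  contains three pairs.\<close>

private definition "rest_ratio = 3 * (1 / (real m + 1)) - 3 * claw_ratio - path_ratio"
private definition "matching_ratio = 1 - 2 * claw_ratio - path_ratio - 2 * rest_ratio"

private lemma m2: "m\<^sup>2 \<ge> 9"
proof -
  have "3\<^sup>2 \<le> m\<^sup>2" using m by (intro power_mono) auto
  thus ?thesis by simp
qed

private lemma V_pos: "V\<^sub>2 > 0" "V\<^sub>3 > 0"
  using m2 by (simp_all add: V\<^sub>2_def V\<^sub>3_def P(1))

private lemma V_real: "real V\<^sub>2 = (real m)\<^sup>2 * ((real m)\<^sup>2 - 1) / 2"
    "real V\<^sub>3 = (real m)\<^sup>2 * ((real m)\<^sup>2 - 1) * ((real m)\<^sup>2 - 2) / 6"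
  by (simp_all add: V\<^sub>2_def V\<^sub>3_def P(1) real_choose_2 real_choose_3)

private lemma P_pairs: "real (subset_count 2 fst 1 P) = 1 / (real m + 1) * real V\<^sub>2"
  "real (subset_count 2 snd 1 P) = 1 / (real m + 1) * real V\<^sub>2"
  unfolding V_real P(2,3) of_nat_mult real_choose_2 by (rule ratio_2, use m in simp)+

private lemma P_claws: "real (subset_count 3 fst 1 P) = claw_ratio * real V\<^sub>3"
  "real (subset_count 3 snd 1 P) = claw_ratio * real V\<^sub>3"
  using ratio_claw[of "real m"] m unfolding V_real P(4,5) of_nat_mult real_choose_3 claw_ratio_def
  by simp_all

private lemma P_path: "real (type_count 3 (2, 2) P) = path_ratio * real V\<^sub>3"
  using ratio_path[of "real m"] m unfolding V_real P(6) path_ratio_def by (simp add: of_nat_diff)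

private lemma P_rest: "real (type_count 3 (2, 3) P) = rest_ratio * real V\<^sub>3"
  "real (type_count 3 (3, 2) P) = rest_ratio * real V\<^sub>3"
proof -
  have sub: "real (card P - 2) = (real m)\<^sup>2 - 2" using m2 by (simp add: P(1) of_nat_diff)
  \<comment> \<open>Each pair of grid points extends to m^2 - 2 triples, and each triple arises
    three times.\<close>
  have V: "real V\<^sub>2 * ((real m)\<^sup>2 - 2) = 3 * real V\<^sub>3" unfolding V_real by simp
  have *: "1 / (real m + 1) * real V\<^sub>2 * ((real m)\<^sup>2 - 2) = 3 * (1 / (real m + 1)) * real V\<^sub>3"
    using V by (simp add: mult.assoc)
  show "real (type_count 3 (2, 3) P) = rest_ratio * real V\<^sub>3"
    using arg_cong[OF type_count_relations(6)[OF fin(2)], of real] *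
    unfolding of_nat_mult of_nat_add sub P_pairs P_claws P_path rest_ratio_def
    by (simp add: algebra_simps)
  show "real (type_count 3 (3, 2) P) = rest_ratio * real V\<^sub>3"
    using arg_cong[OF type_count_relations(7)[OF fin(2)], of real] *
    unfolding of_nat_mult of_nat_add sub P_pairs P_claws P_path rest_ratio_def
    by (simp add: algebra_simps)
qed

private lemma P_matching: "real (type_count 3 (3, 3) P) = matching_ratio * real V\<^sub>3"
  using arg_cong[OF type_count_relations(8)[OF fin(2)], of real]
  unfolding of_nat_add P_claws P_path P_rest matching_ratio_def V\<^sub>3_def[symmetric]
  by (simp add: algebra_simps)

private lemma P_matching_2: "real (type_count 2 (2, 2) P) = (1 - 2 * (1 / (real m + 1))) * real V\<^sub>2"
  using arg_cong[OF type_count_relations(3)[OF fin(2)], of real]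
  unfolding of_nat_add P_pairs V\<^sub>2_def[symmetric] by (simp add: algebra_simps)

private lemma X_pairs_total:
  "real (type_count 2 (2, 2) X)
    = real (k choose 2) - real (subset_count 2 fst 1 X) - real (subset_count 2 snd 1 X)"
  using arg_cong[OF type_count_relations(3)[OF fin(1)], of real] k(1) by simp

private lemma X_rest:
  "real (type_count 3 (2, 3) X) = (real k - 2) * real (subset_count 2 fst 1 X)
    - 3 * real (subset_count 3 fst 1 X) - real (type_count 3 (2, 2) X)"
  "real (type_count 3 (3, 2) X) = (real k - 2) * real (subset_count 2 snd 1 X)
    - 3 * real (subset_count 3 snd 1 X) - real (type_count 3 (2, 2) X)"
  using arg_cong[OF type_count_relations(6)[OF fin(1)], of real]
    arg_cong[OF type_count_relations(7)[OF fin(1)], of real] k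
  by (simp_all add: of_nat_diff algebra_simps)

private lemma X_matching:
  "real (type_count 3 (3, 3) X)
    = real (k choose 3) - real (subset_count 3 fst 1 X) - real (subset_count 3 snd 1 X)
    - real (type_count 3 (2, 2) X) - real (type_count 3 (2, 3) X) - real (type_count 3 (3, 2) X)"
  using arg_cong[OF type_count_relations(8)[OF fin(1)], of real] k(1) by simp

text \<open>The expected number of triples of type (2, 3), in the same shape as
  \<open>X_rest\<close>, so that the two can be compared term by term. It rests on (k-2)(k choose 2)
  = 3(k choose 3).\<close>

private lemma rest_bal:
  "real (k choose 3) * rest_ratio
    = (real k - 2) * pair_bal - 3 * (real (k choose 3) * claw_ratio) - real (k choose 3) * path_ratio"
proof -
  have "(real k - 2) * pair_bal = 3 * (1 / (real m + 1)) * real (k choose 3)"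
    by (simp add: pair_bal_def real_choose_2 real_choose_3 divide_simps)
  thus ?thesis unfolding rest_ratio_def by (simp add: algebra_simps)
qed

lemma balanced_2_iff:
  "(\<forall>c\<in>types\<^sub>2. type_count 2 c X * (card P choose 2) = (k choose 2) * type_count 2 c P) \<longleftrightarrow>
    real (subset_count 2 fst 1 X) = real k * (real k - 1) / (2 * (real m + 1)) \<and>
    real (subset_count 2 snd 1 X) = real k * (real k - 1) / (2 * (real m + 1))"
proof -
  note bal = balanced_iff[OF V_pos(1)]
  have val: "real k * (real k - 1) / (2 * (real m + 1)) = pair_bal"
    unfolding pair_bal_def real_choose_2 by (rule quotient_identities)
  have matching: "real (k choose 2) * (1 - 2 * (1 / (real m + 1)))
    = real (k choose 2) - 2 * pair_bal"
    by (simp add: pair_bal_def algebra_simps)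
  have "(\<forall>c\<in>types\<^sub>2. type_count 2 c X * (card P choose 2) = (k choose 2) * type_count 2 c P) \<longleftrightarrow>
      real (subset_count 2 fst 1 X) = pair_bal \<and> real (subset_count 2 snd 1 X) = pair_bal \<and>
      real (k choose 2) - real (subset_count 2 fst 1 X) - real (subset_count 2 snd 1 X)
        = real (k choose 2) - 2 * pair_bal"
    unfolding V\<^sub>2_def[symmetric] ball_simps(7) ball_simps(5)
      type_count_relations(1,2)[OF fin(1)] type_count_relations(1,2)[OF fin(2)]
      bal[OF P_pairs(1)] bal[OF P_pairs(2)] bal[OF P_matching_2] X_pairs_total
      matching pair_bal_def[symmetric] by simp
  also have "\<dots> \<longleftrightarrow> real (subset_count 2 fst 1 X) = pair_bal \<and> real (subset_count 2 snd 1 X)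
    = pair_bal"
    by auto
  finally show ?thesis unfolding val .
qed

lemma unordered_balanced_2_iff:
  "(subset_count 2 fst 1 X + subset_count 2 snd 1 X) * (card P choose 2)
      = (k choose 2) * (subset_count 2 fst 1 P + subset_count 2 snd 1 P) \<and>
    type_count 2 (2, 2) X * (card P choose 2) = (k choose 2) * type_count 2 (2, 2) P \<longleftrightarrow>
    real (subset_count 2 fst 1 X + subset_count 2 snd 1 X) = real k * (real k - 1) / (real m + 1)"
proof -
  have sum: "real (subset_count 2 fst 1 P + subset_count 2 snd 1 P)
    = 2 * (1 / (real m + 1)) * real V\<^sub>2"
    unfolding of_nat_add P_pairs by simp
  have "real k * (real k - 1) / (real m + 1) = 2 * pair_bal"
    unfolding pair_bal_def real_choose_2 by (rule quotient_identities)
  thus ?thesis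
    unfolding V\<^sub>2_def[symmetric] balanced_iff[OF V_pos(1) sum] balanced_iff[OF V_pos(1) P_matching_2]
      X_pairs_total pair_bal_def
    by (auto simp: algebra_simps)
qed

lemma balanced_3_iff:
  "(\<forall>c\<in>types\<^sub>3. type_count 3 c X * (card P choose 3) = (k choose 3) * type_count 3 c P) \<longleftrightarrow>
    real (subset_count 2 fst 1 X) = real k * (real k - 1) / (2 * (real m + 1)) \<and>
    real (subset_count 2 snd 1 X) = real k * (real k - 1) / (2 * (real m + 1)) \<and>
    real (subset_count 3 fst 1 X) = real k * (real k - 1) * (real k - 2) * (real m - 2)
      / (6 * (real m + 1) * ((real m)\<^sup>2 - 2)) \<and>
    real (subset_count 3 snd 1 X) = real k * (real k - 1) * (real k - 2) * (real m - 2)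
      / (6 * (real m + 1) * ((real m)\<^sup>2 - 2)) \<and>
    real (type_count 3 (2, 2) X) = real k * (real k - 1) * (real k - 2) * (real m - 1)
      / ((real m + 1) * ((real m)\<^sup>2 - 2))"
proof -
  note bal = balanced_iff[OF V_pos(2)]
  define x y a b w where "x = real (subset_count 2 fst 1 X)" and "y = real (subset_count 2 snd 1 X)"
    and "a = real (subset_count 3 fst 1 X)" and "b = real (subset_count 3 snd 1 X)"
    and "w = real (type_count 3 (2, 2) X)"
  define Ka Kw Kb where "Ka = real (k choose 3) * claw_ratio"
    and "Kw = real (k choose 3) * path_ratio"
    and "Kb = real (k choose 3)"
  have vals: "real k * (real k - 1) / (2 * (real m + 1)) = pair_bal"
    "real k * (real k - 1) * (real k - 2) * (real m - 2) / (6 * (real m + 1) * ((real m)\<^sup>2 - 2))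
      = Ka"
    "real k * (real k - 1) * (real k - 2) * (real m - 1) / ((real m + 1) * ((real m)\<^sup>2 - 2)) = Kw"
    unfolding pair_bal_def real_choose_2 real_choose_3 Ka_def Kw_def claw_ratio_def path_ratio_def
    by (rule quotient_identities)+
  have "(\<forall>c\<in>types\<^sub>3. type_count 3 c X * (card P choose 3) = (k choose 3) * type_count 3 c P) \<longleftrightarrow>
      a = Ka \<and> b = Ka \<and> w = Kw \<and>
      (real k - 2) * x - 3 * a - w = (real k - 2) * pair_bal - 3 * Ka - Kw \<and>
      (real k - 2) * y - 3 * b - w = (real k - 2) * pair_bal - 3 * Ka - Kw \<and>
      Kb - a - b - w - ((real k - 2) * x - 3 * a - w) - ((real k - 2) * y - 3 * b - w)
        = Kb - 2 * Ka - Kw - 2 * ((real k - 2) * pair_bal - 3 * Ka - Kw)"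
  proof -
    have mr: "real (k choose 3) * matching_ratio
        = Kb - 2 * Ka - Kw - 2 * ((real k - 2) * pair_bal - 3 * Ka - Kw)"
      unfolding matching_ratio_def Kb_def Ka_def Kw_def rest_bal[symmetric]
        by (simp add: algebra_simps)
    show ?thesis
      unfolding V\<^sub>3_def[symmetric] ball_simps(7) ball_simps(5)
        type_count_relations(4,5)[OF fin(1)] type_count_relations(4,5)[OF fin(2)]
        bal[OF P_claws(1)] bal[OF P_claws(2)] bal[OF P_path] bal[OF P_rest(1)] bal[OF P_rest(2)]
        bal[OF P_matching] X_matching X_rest rest_bal mr
        x_def[symmetric] y_def[symmetric] a_def[symmetric] b_def[symmetric] w_def[symmetric]
      unfolding Ka_def[symmetric] Kw_def[symmetric]
      unfolding Kb_def[symmetric]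
      by simp
  qed
  \<comment> \<open>Once \<open>a\<close>, \<open>b\<close> and \<open>w\<close> have their expected
    values, the fourth and fifth equations read (k-2)x = (k-2)\<open>pair_bal\<close> and the same
    for y, and k - 2 is nonzero. The last equation follows from the others.\<close>
  also have "\<dots> \<longleftrightarrow> x = pair_bal \<and> y = pair_bal \<and> a = Ka \<and> b = Ka \<and> w = Kw"
    using k(2) by auto
  finally show ?thesis unfolding vals x_def y_def a_def b_def w_def .
qed

lemma unordered_balanced_3_iff:
  "(subset_count 3 fst 1 X + subset_count 3 snd 1 X) * (card P choose 3)
      = (k choose 3) * (subset_count 3 fst 1 P + subset_count 3 snd 1 P) \<and>
    type_count 3 (2, 2) X * (card P choose 3) = (k choose 3) * type_count 3 (2, 2) P \<and>
    (type_count 3 (2, 3) X + type_count 3 (3, 2) X) * (card P choose 3)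
      = (k choose 3) * (type_count 3 (2, 3) P + type_count 3 (3, 2) P) \<and>
    type_count 3 (3, 3) X * (card P choose 3) = (k choose 3) * type_count 3 (3, 3) P \<longleftrightarrow>
    real (subset_count 2 fst 1 X + subset_count 2 snd 1 X) = real k * (real k - 1) / (real m + 1) \<and>
    real (subset_count 3 fst 1 X + subset_count 3 snd 1 X)
      = real k * (real k - 1) * (real k - 2) * (real m - 2)
      / (3 * (real m + 1) * ((real m)\<^sup>2 - 2)) \<and>
    real (type_count 3 (2, 2) X) = real k * (real k - 1) * (real k - 2) * (real m - 1)
      / ((real m + 1) * ((real m)\<^sup>2 - 2))"
proof -
  note bal = balanced_iff[OF V_pos(2)]
  have claws: "real (subset_count 3 fst 1 P + subset_count 3 snd 1 P) = 2 * claw_ratio * real V\<^sub>3"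
    unfolding of_nat_add P_claws by simp
  have rest: "real (type_count 3 (2, 3) P + type_count 3 (3, 2) P) = 2 * rest_ratio * real V\<^sub>3"
    unfolding of_nat_add P_rest by simp
  define x y a b w where "x = real (subset_count 2 fst 1 X)" and "y = real (subset_count 2 snd 1 X)"
    and "a = real (subset_count 3 fst 1 X)" and "b = real (subset_count 3 snd 1 X)"
    and "w = real (type_count 3 (2, 2) X)"
  define Ka Kw Kb where "Ka = real (k choose 3) * claw_ratio"
    and "Kw = real (k choose 3) * path_ratio"
    and "Kb = real (k choose 3)"
  have vals: "real k * (real k - 1) / (real m + 1) = 2 * pair_bal"
    "real k * (real k - 1) * (real k - 2) * (real m - 2) / (3 * (real m + 1) * ((real m)\<^sup>2 - 2))
      = 2 * Ka"
    "real k * (real k - 1) * (real k - 2) * (real m - 1) / ((real m + 1) * ((real m)\<^sup>2 - 2)) = Kw"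
    unfolding pair_bal_def real_choose_2 real_choose_3 Ka_def Kw_def claw_ratio_def path_ratio_def
    by (rule quotient_identities)+
  let ?e = "(real k - 2) * x - 3 * a - w" and ?f = "(real k - 2) * y - 3 * b - w"
    and ?r = "(real k - 2) * pair_bal - 3 * Ka - Kw"
  have mr: "real (k choose 3) * matching_ratio = Kb - 2 * Ka - Kw - 2 * ?r"
    unfolding matching_ratio_def Kb_def Ka_def Kw_def rest_bal[symmetric]
      by (simp add: algebra_simps)
  have rr: "real (k choose 3) * (2 * rest_ratio) = 2 * ?r"
    "real (k choose 3) * (2 * claw_ratio) = 2 * Ka"
    unfolding Ka_def Kw_def rest_bal[symmetric] by simp_all
  \<comment> \<open>In the sum of the two mixed counts the claws enter only as a + b; with claws and
    3-paths fixed, only the total number of 2-paths remains.\<close>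
  have "?e + ?f = 2 * ?r \<longleftrightarrow> (real k - 2) * (x + y) = (real k - 2) * (2 * pair_bal)"
    if "a + b = 2 * Ka" "w = Kw"
    using that by (simp add: algebra_simps) linarith
  hence eq: "?e + ?f = 2 * ?r \<longleftrightarrow> x + y = 2 * pair_bal" if "a + b = 2 * Ka" "w = Kw"
    using that k(2) by simp
  have "?thesis \<longleftrightarrow> (a + b = 2 * Ka \<and> w = Kw \<and> ?e + ?f = 2 * ?r \<and>
      Kb - a - b - w - ?e - ?f = Kb - 2 * Ka - Kw - 2 * ?r \<longleftrightarrow>
      x + y = 2 * pair_bal \<and> a + b = 2 * Ka \<and> w = Kw)"
    unfolding V\<^sub>3_def[symmetric] bal[OF claws] bal[OF P_path] bal[OF rest] bal[OF P_matching]
      vals of_nat_add X_matching X_rest mr rr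
      x_def[symmetric] y_def[symmetric] a_def[symmetric] b_def[symmetric] w_def[symmetric]
      Kw_def[symmetric]
    unfolding Kb_def[symmetric] ..
  \<comment> \<open>The matchings make up the rest of the k-set's triples, so their equation follows
    from the other three.\<close>
  moreover have "Kb - a - b - w - ?e - ?f = Kb - 2 * Ka - Kw - 2 * ?r"
    if "a + b = 2 * Ka" "w = Kw" "?e + ?f = 2 * ?r"
    using that by linarith
  ultimately show ?thesis using eq by blast
qed

end

section \<open>Degrees and the main theorem\<close>

context bipartition
begin

lemma subset_count_Times:
  assumes "card Rs = m" "card Cs = m" "t > 0"
  shows "subset_count t fst 1 (Rs \<times> Cs) = m * (m choose t)" "subset_count t snd 1 (Rs \<times> Cs)
    = m * (m choose t)"
proof -
  have "{p \<in> Rs \<times> Cs. fst p = r} = {r} \<times> Cs" if "r \<in> Rs" for r using that by auto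
  hence "(\<Sum>r\<in>Rs. card {p \<in> Rs \<times> Cs. fst p = r} choose t) = (\<Sum>r\<in>Rs. m choose t)"
    using assms(2) by (intro sum.cong) (simp_all add: card_cartesian_product)
  moreover have "subset_count t fst 1 (Rs \<times> Cs) = (\<Sum>r\<in>Rs. card {p \<in> Rs \<times> Cs. fst p = r} choose t)"
    using finite_Rs finite_Cs assms(3) by (intro subset_count_one) auto
  ultimately show "subset_count t fst 1 (Rs \<times> Cs) = m * (m choose t)" using assms(1) by simp
  have "{p \<in> Rs \<times> Cs. snd p = c} = Rs \<times> {c}" if "c \<in> Cs" for c using that by auto
  hence "(\<Sum>c\<in>Cs. card {p \<in> Rs \<times> Cs. snd p = c} choose t) = (\<Sum>c\<in>Cs. m choose t)"
    using assms(1) by (intro sum.cong) (simp_all add: card_cartesian_product)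
  moreover have "subset_count t snd 1 (Rs \<times> Cs) = (\<Sum>c\<in>Cs. card {p \<in> Rs \<times> Cs. snd p = c} choose t)"
    using finite_Rs finite_Cs assms(3) by (intro subset_count_one) auto
  ultimately show "subset_count t snd 1 (Rs \<times> Cs) = m * (m choose t)" using assms(2) by simp
qed

text \<open>The points of the block in a given row or column are the edges at that vertex, so the
  fibre sizes are the degrees.\<close>

lemma subset_count_degrees:
  assumes "X \<subseteq> Kmm_edges Rs Cs" "t > 0"
  shows "subset_count t fst 1 (B Rs Cs X) = (\<Sum>r\<in>Rs. degree X r choose t)"
    and "subset_count t snd 1 (B Rs Cs X) = (\<Sum>c\<in>Cs. degree X c choose t)"
proof -
  have "subset_count t fst 1 (B Rs Cs X) = (\<Sum>r\<in>Rs. card {p \<in> B Rs Cs X. fst p = r} choose t)"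
    using finite_B finite_Rs assms(2) B_sub[of X] by (intro subset_count_one) auto
  thus "subset_count t fst 1 (B Rs Cs X) = (\<Sum>r\<in>Rs. degree X r choose t)"
    using degree_row[OF assms(1)] by simp
  have "subset_count t snd 1 (B Rs Cs X) = (\<Sum>c\<in>Cs. card {p \<in> B Rs Cs X. snd p = c} choose t)"
    using finite_B finite_Cs assms(2) B_sub[of X] by (intro subset_count_one) auto
  thus "subset_count t snd 1 (B Rs Cs X) = (\<Sum>c\<in>Cs. degree X c choose t)"
    using degree_column[OF assms(1)] by simp
qed

end

theorem corollary3p7:
  fixes m k :: nat
    and R C :: "nat \<Rightarrow> 'v"
    and \<Delta> :: "'v set set"
    and x y :: "nat \<Rightarrow> nat"
  assumes "m > 0" and "k > 0"
    and "3 \<le> k" and "real k \<le> (real m)\<^sup>2 / 2"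
    and "inj_on R {1..m}" and "inj_on C {1..m}"
    and "R ` {1..m} \<inter> C ` {1..m} = {}"
    and "\<Delta> \<subseteq> Kmm_edges (R ` {1..m}) (C ` {1..m})"
    and "card \<Delta> = k"
    and "\<And>i. i \<in> {1..m} \<Longrightarrow> x i = degree \<Delta> (R i)"
    and "\<And>j. j \<in> {1..m} \<Longrightarrow> y j = degree \<Delta> (C j)"
  shows
    "(cond_A m k \<Delta> \<longleftrightarrow>
        real ((\<Sum>i=1..m. x i choose 2) + (\<Sum>j=1..m. y j choose 2))
          = real k * (real k - 1) / (real m + 1))
     \<and> card (claws3 \<Delta>) = (\<Sum>i=1..m. x i choose 3) + (\<Sum>j=1..m. y j choose 3)
     \<and> (t_design 2 (D_hat m R C \<Delta>) \<and> \<not> t_design 2 (D m R C \<Delta>) \<longleftrightarrow>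
          cond_A m k \<Delta> \<and>
          real (\<Sum>i=1..m. x i choose 2) \<noteq> real k * (real k - 1) / (2 * (real m + 1)))
     \<and> (t_design 3 (D_hat m R C \<Delta>) \<and> \<not> t_design 3 (D m R C \<Delta>) \<longleftrightarrow>
          cond_A m k \<Delta> \<and> cond_B m k \<Delta> \<and> cond_C m k \<Delta> \<and>
          (real (\<Sum>i=1..m. x i choose 2) \<noteq> real k * (real k - 1) / (2 * (real m + 1)) \<or>
           real (\<Sum>i=1..m. x i choose 3) \<noteq>
             real k * (real k - 1) * (real k - 2) * (real m - 2)
             / (6 * (real m + 1) * ((real m)\<^sup>2 - 2))))"
proof -
  let ?R = "R ` {1..m}" and ?C = "C ` {1..m}"
  let ?S = "B ?R ?C \<Delta>" and ?P = "?R \<times> ?C"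
  interpret bipartition ?R ?C
    by unfold_locales (use assms(7) in auto)
  have cards: "card ?R = m" "card ?C = m" using assms(5,6) by (simp_all add: card_image)
  have m3: "m \<ge> 3"
  \<comment> \<open>The bounds on k give m^2 at least 6, which m at most 2 cannot satisfy.\<close>
  proof (rule ccontr)
    assume "\<not> m \<ge> 3"
    hence "(real m)\<^sup>2 \<le> 2\<^sup>2" by (intro power_mono) auto
    thus False using assms(3,4) by simp
  qed
  have "inj_on edge ?S" using inj_edge B_sub inj_on_subset by blast
  hence card_S: "card ?S = k"
    using edge_image_B[OF assms(8)] card_image assms(9) by metis
  have card_P: "card ?P = m\<^sup>2" using cards by (simp add: card_cartesian_product power2_eq_square)
  have fin: "finite ?S" "finite ?P" using finite_B by auto
  have path_P: "type_count 3 (2, 2) ?P = (m * (m - 1))\<^sup>2"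
    using type_count_path_Times[of ?R ?C m] cards by simp
  have sizes: "0 < (2::nat)" "0 < (3::nat)" by simp_all
  note data = fin m3 card_S assms(3) card_P subset_count_Times[OF cards sizes(1)]
    subset_count_Times[OF cards sizes(2)] path_P

  have degrees: "(\<Sum>i=1..m. x i choose t) = subset_count t fst 1 ?S"
    "(\<Sum>j=1..m. y j choose t) = subset_count t snd 1 ?S" if "t > 0" for t
    unfolding subset_count_degrees[OF assms(8) that]
    unfolding sum.reindex[OF assms(5)] sum.reindex[OF assms(6)] comp_def
    using assms(10,11) by (auto intro!: sum.cong)
  have claws: "card (claws3 \<Delta>) = subset_count 3 fst 1 ?S + subset_count 3 snd 1 ?S"
    by (rule card_claws3[OF assms(8)])
  have condA: "cond_A m k \<Delta> \<longleftrightarrow> real (subset_count 2 fst 1 ?S + subset_count 2 snd 1 ?S)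
      = real k * (real k - 1) / (real m + 1)"
    unfolding cond_A_def card_paths_2[OF assms(8)] ..
  have condB: "cond_B m k \<Delta> \<longleftrightarrow> real (subset_count 3 fst 1 ?S + subset_count 3 snd 1 ?S)
      = real k * (real k - 1) * (real k - 2) * (real m - 2)
        / (3 * (real m + 1) * ((real m)\<^sup>2 - 2))"
    unfolding cond_B_def claws ..
  have condC: "cond_C m k \<Delta> \<longleftrightarrow> real (type_count 3 (2, 2) ?S)
      = real k * (real k - 1) * (real k - 2) * (real m - 1) / ((real m + 1) * ((real m)\<^sup>2 - 2))"
    unfolding cond_C_def card_paths_3[OF assms(8)] ..

  have D: "t_design 2 (D m R C \<Delta>) \<longleftrightarrow>
      (\<forall>c\<in>types\<^sub>2. type_count 2 c ?S * (card ?P choose 2) = (k choose 2) * type_count 2 c ?P)"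
    "t_design 3 (D m R C \<Delta>) \<longleftrightarrow>
      (\<forall>c\<in>types\<^sub>3. type_count 3 c ?S * (card ?P choose 3) = (k choose 3) * type_count 3 c ?P)"
    unfolding D_def
    using t_design_fixing_iff[of 2 \<Delta>] t_design_fixing_iff[of 3 \<Delta>] assms(3,8) card_S
    by (simp_all only: all_types\<^sub>2_iff all_types\<^sub>3_iff simp_thms)

  have tau: "tau m R C \<in> swapping"
    unfolding swapping_def using tau_swapping[OF assms(5-7)] by blast
  have G_sub: "G m R C \<subseteq> fixing \<union> swapping"
    unfolding G_def K_eq using generate_sub[of "fixing \<union> {tau m R C}"] tau by blast
  have fixing_sub: "fixing \<subseteq> G m R C" and tau_G: "tau m R C \<in> G m R C"
    unfolding G_def K_eq by (auto intro: generate.incl)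
  have G_comp: "g \<circ> h \<in> G m R C" if "g \<in> G m R C" "h \<in> G m R C" for g h
    using generate.eng[OF that[unfolded G_def]] unfolding G_def by (simp add: Sym_def)
  note D_hat_iff = t_design_full_iff[OF _ fixing_sub G_sub tau_G tau G_comp assms(8), folded D_hat_def]
  have D_hat_2: "t_design 2 (D_hat m R C \<Delta>) \<longleftrightarrow> cond_A m k \<Delta>"
    using D_hat_iff[of 2] assms(3) card_S
    unfolding all_unordered_types\<^sub>2_iff[OF fin] condA
    using unordered_balanced_2_iff[OF data] by simp
  have D_hat_3: "t_design 3 (D_hat m R C \<Delta>) \<longleftrightarrow> cond_A m k \<Delta> \<and> cond_B m k \<Delta> \<and> cond_C m k \<Delta>"
    using D_hat_iff[of 3] assms(3) card_S
    unfolding all_unordered_types\<^sub>3_iff[OF fin] condA condB condC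
    using unordered_balanced_3_iff[OF data] by simp

  define p q where "p = real (subset_count 2 fst 1 ?S)" and "q = real (subset_count 2 snd 1 ?S)"
  define a b where "a = real (subset_count 3 fst 1 ?S)" and "b = real (subset_count 3 snd 1 ?S)"
  \<comment> \<open>\<open>h\<close> and \<open>g\<close> are the values that rows alone must attain
    for K; conditions (A) and (B) ask for 2h and 2g for rows and columns together.\<close>
  define h where "h = real k * (real k - 1) / (2 * (real m + 1))"
  define g where "g = real k * (real k - 1) * (real k - 2) * (real m - 2)
    / (6 * (real m + 1) * ((real m)\<^sup>2 - 2))"
  have h2: "real k * (real k - 1) / (real m + 1) = 2 * h"
    and g2: "real k * (real k - 1) * (real k - 2) * (real m - 2)
      / (3 * (real m + 1) * ((real m)\<^sup>2 - 2)) = 2 * g"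
    unfolding h_def g_def quotient_identities(1,3) by (rule quotient_identities)+
  have A: "cond_A m k \<Delta> \<longleftrightarrow> p + q = 2 * h" and B: "cond_B m k \<Delta> \<longleftrightarrow> a + b = 2 * g"
    unfolding condA condB h2 g2 by (simp_all add: p_def q_def a_def b_def)
  have D_2: "t_design 2 (D m R C \<Delta>) \<longleftrightarrow> p = h \<and> q = h"
    unfolding D balanced_2_iff[OF data] p_def q_def h_def ..
  have D_3: "t_design 3 (D m R C \<Delta>) \<longleftrightarrow> p = h \<and> q = h \<and> a = g \<and> b = g \<and> cond_C m k \<Delta>"
    unfolding D balanced_3_iff[OF data] condC p_def q_def a_def b_def h_def g_def ..
  have sums: "real (\<Sum>i=1..m. x i choose 2) = p" "real (\<Sum>i=1..m. x i choose 3) = a"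
    unfolding degrees[OF sizes(1)] degrees[OF sizes(2)] p_def a_def by (rule refl)+
  \<comment> \<open>Given p + q = 2h, the conditions p = h and q = h are equivalent, and likewise
    for a, b and g; condition (C) is common to both structures. So the negated K-condition reduces
    to p or a missing its value.\<close>
  show ?thesis
  proof (intro conjI)
    show "cond_A m k \<Delta> \<longleftrightarrow>
        real ((\<Sum>i=1..m. x i choose 2) + (\<Sum>j=1..m. y j choose 2))
          = real k * (real k - 1) / (real m + 1)"
      unfolding degrees[OF sizes(1)] condA ..
    show "card (claws3 \<Delta>) = (\<Sum>i=1..m. x i choose 3) + (\<Sum>j=1..m. y j choose 3)"
      unfolding degrees[OF sizes(2)] claws ..
  qed (unfold D_hat_2 D_hat_3 D_2 D_3 sums A B, fold h_def g_def, auto)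
qed

end
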